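(* Let $K$ be a field, let $\mathcal{F}=\{F_1,\ldots,F_t\}$ be a homogeneous regular sequence in $R=K[x_1,\ldots,x_n]$, let $2\le c\le \min\{n,t\}$, and let $$I=I_{c,\mathcal{F}}=\bigcap_{1\le i_1<\cdots<i_c\le t}(F_{i_1},\ldots,F_{i_c})$$ be the ideal of the star configuration of height $c$ on $\mathcal{F}$. Then for every $m\ge 1$ the ideal $I^m$ is of fiber type. Moreover, the defining ideal of the fiber cone $F(I^m)$ is generated by polynomials of degree at most two.
   Context: $R=K[x_1,\ldots,x_n]$ is standard graded. For a homogeneous ideal $J_0\subseteq R$ with minimal generating set $g_1,\ldots,g_\mu$, the Rees algebra is $\mathcal{R}(J_0)=\bigoplus_{i\ge0}J_0^i\tau^i=R[g_1\tau,\ldots,g_\mu\tau]\subseteq R[\tau]$, where $\tau$ is an indeterminate. Let $S=R[T_1,\ldots,T_\mu]$; the defining ideal of $\mathcal{R}(J_0)$ is the kernel $\mathcal{J}$ of the $R$-algebra map $S\to\mathcal{R}(J_0)$, $T_i\mapsto g_i\tau$. Let $\mathcal{L}\subseteq\mathcal{J}$ be the ideal generated by the elements of $\mathcal{J}$ that are homogeneous of degree one in the $T$-variables. The fiber cone is $F(J_0)=\mathcal{R}(J_0)\otimes_R K$ (where $K=R/(x_1,\ldots,x_n)$), and its defining ideal is the kernel $\mathcal{I}$ of the induced surjection $K[T_1,\ldots,T_\mu]\to F(J_0)$. The ideal $J_0$ is of fiber type if $\mathcal{J}=\mathcal{L}+\mathcal{I}S$. Under the hypotheses of the claim, $I^m$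 has a minimal generating set consisting of products $F_1^{a_1}\cdots F_t^{a_t}$ with integers $a_i\ge0$, and the generators $g_1,\ldots,g_\mu$ of $I^m$ are taken to be of this form. *)

theory Defs
  imports
    "HOL-Library.Cardinality"
    "HOL-Library.Poly_Mapping"
    "HOL-Library.Set_Algebras"
    "HOL-Computational_Algebra.Polynomial"
    "HOL-Algebra.QuotRing"
begin

section \<open>Polynomial rings in finitely many variables\<close>

text \<open>
  For a finite type \<^typ>\<open>'x\<close>, the type below is the polynomial ring over \<^typ>\<open>'a\<close> with variables
  indexed by the elements of \<^typ>\<open>'x\<close>; exponent vectors are elements of \<^typ>\<open>'x \<Rightarrow>\<^sub>0 nat\<close>.
\<close>

type_synonym ('x, 'a) mpoly = "('x \<Rightarrow>\<^sub>0 nat) \<Rightarrow>\<^sub>0 'a"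

definition mp_const :: "'a::zero \<Rightarrow> ('x, 'a) mpoly" where
  "mp_const a = Poly_Mapping.single 0 a"

definition mp_var :: "'x \<Rightarrow> ('x, 'a::zero_neq_one) mpoly" where
  "mp_var i = Poly_Mapping.single (Poly_Mapping.single i 1) 1"

definition mdeg :: "('x::finite \<Rightarrow>\<^sub>0 nat) \<Rightarrow> nat" where
  "mdeg a = (\<Sum>i\<in>UNIV. Poly_Mapping.lookup a i)"

definition homogeneous :: "nat \<Rightarrow> ('x::finite, 'a::zero) mpoly \<Rightarrow> bool" where
  "homogeneous d p \<longleftrightarrow> (\<forall>a\<in>Poly_Mapping.keys p. mdeg a = d)"

definition total_degree :: "('x::finite, 'a::zero) mpoly \<Rightarrow> nat" where
  "total_degree p = Max (insert 0 (mdeg ` Poly_Mapping.keys p))"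

text \<open>
  The ring map out of a polynomial ring that is \<open>h\<close> on coefficients and sends the \<open>i\<close>-th variable
  to \<open>v i\<close>.
\<close>

definition mp_eval :: "('a::zero \<Rightarrow> 'b) \<Rightarrow> ('x::finite \<Rightarrow> 'b) \<Rightarrow> ('x, 'a) mpoly \<Rightarrow> 'b::comm_semiring_1"
  where "mp_eval h v p =
    (\<Sum>a\<in>Poly_Mapping.keys p. h (Poly_Mapping.lookup p a) * (\<Prod>i\<in>UNIV. v i ^ Poly_Mapping.lookup a i))"

text \<open>The inclusion of \<open>K[T]\<close> into \<open>S = R[T]\<close>, where \<open>R = K[x]\<close>.\<close>

definition extend_coeffs :: "('m, 'k::zero) mpoly \<Rightarrow> ('m, ('n, 'k) mpoly) mpoly" where
  "extend_coeffs p = Poly_Mapping.map mp_const p"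


section \<open>Ideals\<close>

definition ideal_gen :: "'a::comm_ring_1 set \<Rightarrow> 'a set" where
  "ideal_gen A = Modules.module.span (*) A"

fun ideal_power :: "'a::comm_ring_1 set \<Rightarrow> nat \<Rightarrow> 'a set" where
  "ideal_power J 0 = UNIV"
| "ideal_power J (Suc m) = ideal_gen {a * b | a b. a \<in> J \<and> b \<in> ideal_power J m}"

text \<open>
  An irredundant finite generating set. For homogeneous generators this is the same as having
  the least possible number of elements.
\<close>

definition minimal_generating_set :: "'a::comm_ring_1 set \<Rightarrow> 'a set \<Rightarrow> bool" where
  "minimal_generating_set J G \<longleftrightarrow>
     finite G \<and> ideal_gen G = J \<and> (\<forall>G'. G' \<subset> G \<longrightarrow> ideal_gen G' \<noteq> J)"

text \<open>The sequence is \<open>F 1, \<dots>, F t\<close>; the ideal it generates is required to be proper.\<close>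

definition regular_sequence :: "(nat \<Rightarrow> 'a::comm_ring_1) \<Rightarrow> nat \<Rightarrow> bool" where
  "regular_sequence F t \<longleftrightarrow>
     (\<forall>i\<in>{1..t}. \<forall>r. F i * r \<in> ideal_gen (F ` {1..<i}) \<longrightarrow> r \<in> ideal_gen (F ` {1..<i})) \<and>
     ideal_gen (F ` {1..t}) \<noteq> UNIV"

definition star_configuration :: "nat \<Rightarrow> (nat \<Rightarrow> 'a::comm_ring_1) \<Rightarrow> nat \<Rightarrow> 'a set" where
  "star_configuration c F t = (\<Inter>A\<in>{A. A \<subseteq> {1..t} \<and> card A = c}. ideal_gen (F ` A))"

definition power_products :: "(nat \<Rightarrow> 'a::comm_ring_1) \<Rightarrow> nat \<Rightarrow> 'a set" where
  "power_products F t = {\<Prod>i\<in>{1..t}. F i ^ a i | a :: nat \<Rightarrow> nat. True}"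


section \<open>Rees algebra and fiber cone\<close>

text \<open>
  The Rees algebra of \<open>J\<close> is the subring of \<open>R[\<tau>]\<close> (library type \<^typ>\<open>'a poly\<close>) of those polynomials
  whose \<open>i\<close>-th coefficient lies in the \<open>i\<close>-th power of \<open>J\<close>.
\<close>

definition rees_ring :: "'a::comm_ring_1 set \<Rightarrow> 'a poly ring" where
  "rees_ring J =
     \<lparr>carrier = {p. \<forall>i. coeff p i \<in> ideal_power J i}, mult = (*), one = 1, zero = 0, add = (+)\<rparr>"

text \<open>
  The map \<open>S \<rightarrow> R[\<tau>]\<close>, \<open>T\<^sub>i \<mapsto> g\<^sub>i \<tau>\<close>; its image is the Rees algebra of the ideal generated by
  the \<open>g\<^sub>i\<close>.
\<close>

definition rees_map :: "('m::finite \<Rightarrow> 'a::comm_ring_1) \<Rightarrow> ('m, 'a) mpoly \<Rightarrow> 'a poly" where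
  "rees_map g = mp_eval (\<lambda>r. [:r:]) (\<lambda>i. monom (g i) 1)"

definition rees_defining_ideal :: "('m::finite \<Rightarrow> 'a::comm_ring_1) \<Rightarrow> ('m, 'a) mpoly set" where
  "rees_defining_ideal g = {p. rees_map g p = 0}"

definition linear_part :: "('m::finite \<Rightarrow> 'a::comm_ring_1) \<Rightarrow> ('m, 'a) mpoly set" where
  "linear_part g = ideal_gen {p \<in> rees_defining_ideal g. homogeneous 1 p}"

text \<open>
  The tensor product of the Rees algebra with \<open>K = R/(x\<^sub>1, \<dots>, x\<^sub>n)\<close> over \<open>R\<close> is the quotient of the
  Rees algebra by the ideal generated (in the Rees algebra) by the variables of \<open>R\<close>.
\<close>

definition rees_irrelevant :: "('n, 'k::field) mpoly set \<Rightarrow> ('n, 'k) mpoly poly set" where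
  "rees_irrelevant J = genideal (rees_ring J) {[:mp_var i:] | i. True}"

definition fiber_cone :: "('n, 'k::field) mpoly set \<Rightarrow> ('n, 'k) mpoly poly set ring" where
  "fiber_cone J = rees_ring J Quot rees_irrelevant J"

definition fiber_map ::
  "('n, 'k::field) mpoly set \<Rightarrow> ('m::finite \<Rightarrow> ('n, 'k) mpoly) \<Rightarrow> ('m, 'k) mpoly \<Rightarrow> ('n, 'k) mpoly poly set"
  where "fiber_map J g p = rees_irrelevant J +>\<^bsub>rees_ring J\<^esub> rees_map g (extend_coeffs p)"

definition fiber_defining_ideal ::
  "('n, 'k::field) mpoly set \<Rightarrow> ('m::finite \<Rightarrow> ('n, 'k) mpoly) \<Rightarrow> ('m, 'k) mpoly set"
  where "fiber_defining_ideal J g = {p. fiber_map J g p = \<zero>\<^bsub>fiber_cone J\<^esub>}"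

text \<open>
  Fiber type is taken relative to the generators \<open>g\<close>: if they do not all have the same degree,
  the condition may depend on that choice.
\<close>

definition fiber_type :: "('n, 'k::field) mpoly set \<Rightarrow> ('m::finite \<Rightarrow> ('n, 'k) mpoly) \<Rightarrow> bool" where
  "fiber_type J g \<longleftrightarrow>
     rees_defining_ideal g = linear_part g + ideal_gen (extend_coeffs ` fiber_defining_ideal J g)"

end

theory Submission
  imports Defs
begin

text \<open>
  A homogeneous regular sequence \<open>F\<close> behaves like a set of variables: if \<open>W\<close> is a complement of the ideal
  \<open>(F)\<close> spanned by monomials, then every ring element is uniquely a finite sum of terms \<open>w\<^sub>c F\<^bsup>c\<^esup>\<close> with
  \<open>w\<^sub>c \<in> W\<close>. Hence ideals generated by products of the \<open>F\<^sub>i\<close> intersect and multiply like monomial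
  ideals, and \<open>I\<^bsup>m\<^esup>\<close> is minimally generated by the products \<open>F\<^bsup>a\<^esup>\<close> of Veronese type, that is, with
  \<open>|a| = m (t - c + 1)\<close> and all exponents at most \<open>m\<close>.

  Expanding the coefficients of a polynomial relation among the generators splits it into differences of
  terms \<open>F\<^bsup>p\<^esup> T\<^bsup>\<alpha>\<^esup>\<close> with the same image in the Rees algebra. Two such terms are joined by a chain of
  elementary steps, each moving a single unit: either between two exponents (a quadratic relation
  with constant coefficients) or between one exponent and \<open>p\<close> (a linear relation). Finally, a relation
  over \<open>K\<close> in the fiber cone is already a relation in the Rees algebra, since reducing the coefficients of
  lowest order modulo the variables loses nothing over \<open>K\<close>.
\<close>

section \<open>Ideals\<close>

text \<open>Two obstacles shape the development. The \<open>F i\<close> may have different degrees,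
  so the generators of the power need not share a degree, and comparing degrees in the
  \<open>x\<close>-variables does not isolate the fiber cone. All generators do have the same order
  \<open>e\<close> with respect to the powers of \<open>(F)\<close>, and this order takes the place
  of the degree. Second, the complement \<open>W\<close> is only a subgroup, so a product of two
  coefficients has to be expanded again. Expansions are therefore controlled through two rules only:
  they add, and multiplying by a product of the \<open>F i\<close> shifts their exponents.
  Homogeneity enters to make expansions finite. On the combinatorial side, a unit can be exchanged
  between two exponents when one has room below the cap \<open>m\<close> and the other has supply.
  Room and supply may sit in different factors of a monomial; bringing them together in one factor
  is the step on which both connectivity arguments rest.\<close>

interpretation ring_module: module "(*) :: 'a::comm_ring_1 \<Rightarrow> 'a \<Rightarrow> 'a"
  by unfold_locales (simp_all add: algebra_simps)

text \<open>As a rewrite rule, this fact of the module locale loops with \<open>mult.assoc\<close>.\<close>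

declare ring_module.scale_scale [simp del]

abbreviation is_ideal :: "'a::comm_ring_1 set \<Rightarrow> bool" where
  "is_ideal \<equiv> module.subspace (*)"

lemma is_idealI:
  assumes "0 \<in> H" "\<And>x y. x \<in> H \<Longrightarrow> y \<in> H \<Longrightarrow> x + y \<in> H" "\<And>r x. x \<in> H \<Longrightarrow> r * x \<in> H"
  shows "is_ideal H"
  using assms by (auto simp: ring_module.subspace_def)

lemma is_ideal_ideal_gen: "is_ideal (ideal_gen A)"
  unfolding ideal_gen_def by (rule ring_module.subspace_span)

lemmas ideal_gen_zero = ring_module.subspace_0[OF is_ideal_ideal_gen]
  and ideal_gen_add = ring_module.subspace_add[OF is_ideal_ideal_gen]
  and ideal_gen_diff = ring_module.subspace_diff[OF is_ideal_ideal_gen]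
  and ideal_gen_mult = ring_module.subspace_scale[OF is_ideal_ideal_gen]
  and ideal_gen_sum = ring_module.subspace_sum[OF is_ideal_ideal_gen]

lemma ideal_gen_base: "a \<in> A \<Longrightarrow> a \<in> ideal_gen A"
  unfolding ideal_gen_def by (rule ring_module.span_base)

lemma ideal_gen_minimal: "A \<subseteq> H \<Longrightarrow> is_ideal H \<Longrightarrow> ideal_gen A \<subseteq> H"
  unfolding ideal_gen_def by (rule ring_module.span_minimal)

lemma ideal_gen_mono: "A \<subseteq> B \<Longrightarrow> ideal_gen A \<subseteq> ideal_gen B"
  unfolding ideal_gen_def by (rule ring_module.span_mono)

lemma ideal_gen_eq_UNIV_iff: "ideal_gen A = UNIV \<longleftrightarrow> 1 \<in> ideal_gen A"
  using ideal_gen_mult[of 1 A] by auto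

lemma is_ideal_sum_set:
  assumes A: "is_ideal A" and B: "is_ideal B"
  shows "is_ideal (A + B)"
proof (rule is_idealI)
  show "0 \<in> A + B"
    using set_plus_intro[OF ring_module.subspace_0[OF A] ring_module.subspace_0[OF B]] by simp
next
  fix x y assume "x \<in> A + B" "y \<in> A + B"
  then obtain a b a' b' where "x = a + b" "y = a' + b'" "a \<in> A" "b \<in> B" "a' \<in> A" "b' \<in> B"
    by (elim set_plus_elim)
  then show "x + y \<in> A + B"
    using set_plus_intro[OF ring_module.subspace_add[OF A, of a a'] ring_module.subspace_add[OF B, of b b']]
    by (simp add: ac_simps)
next
  fix r x assume "x \<in> A + B"
  then obtain a b where "x = a + b" "a \<in> A" "b \<in> B"
    by (elim set_plus_elim)
  then show "r * x \<in> A + B"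
    using set_plus_intro[OF ring_module.subspace_scale[OF A, of a r] ring_module.subspace_scale[OF B, of b r]]
    by (simp add: distrib_left)
qed

lemma ideal_gen_finite:
  assumes "finite A" shows "ideal_gen (f ` A) = {\<Sum>a\<in>A. f a * s a | s. True}"
proof
  have "is_ideal {\<Sum>a\<in>A. f a * s a | s. True}" (is "is_ideal ?H")
  proof (rule is_idealI)
    show "0 \<in> ?H" by (auto intro!: exI[of _ "\<lambda>_. 0"])
  next
    fix x y assume "x \<in> ?H" "y \<in> ?H"
    then obtain s s' where "x = (\<Sum>a\<in>A. f a * s a)" "y = (\<Sum>a\<in>A. f a * s' a)" by auto
    then have "x + y = (\<Sum>a\<in>A. f a * (s a + s' a))" by (simp add: sum.distrib distrib_left)
    then show "x + y \<in> ?H" by (auto intro!: exI[of _ "\<lambda>a. s a + s' a"])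
  next
    fix r x assume "x \<in> ?H"
    then obtain s where "x = (\<Sum>a\<in>A. f a * s a)" by auto
    then have "r * x = (\<Sum>a\<in>A. f a * (r * s a))" by (simp add: sum_distrib_left ac_simps)
    then show "r * x \<in> ?H" by (auto intro!: exI[of _ "\<lambda>a. r * s a"])
  qed
  moreover have "f ` A \<subseteq> ?H"
  proof safe
    fix a assume "a \<in> A"
    have "f a = (\<Sum>b\<in>A. f b * (if b = a then 1 else 0))"
      using assms \<open>a \<in> A\<close> by (simp add: sum.delta if_distrib cong: if_cong)
    then show "\<exists>s. f a = (\<Sum>b\<in>A. f b * s b) \<and> True" by (intro exI[of _ "\<lambda>b. if b = a then 1 else 0"]) simp
  qed
  ultimately show "ideal_gen (f ` A) \<subseteq> ?H" by (rule ideal_gen_minimal[rotated])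
  show "?H \<subseteq> ideal_gen (f ` A)"
  proof safe
    fix s
    have "s a * f a \<in> ideal_gen (f ` A)" if "a \<in> A" for a
      using that by (intro ideal_gen_mult ideal_gen_base) auto
    then show "(\<Sum>a\<in>A. f a * s a) \<in> ideal_gen (f ` A)" by (intro ideal_gen_sum) (simp add: mult.commute)
  qed
qed

lemma ideal_gen_products:
  "ideal_gen {a * b | a b. a \<in> ideal_gen A \<and> b \<in> ideal_gen B} = ideal_gen {a * b | a b. a \<in> A \<and> b \<in> B}"
    (is "ideal_gen ?L = ideal_gen ?R")
proof
  have 1: "a * b \<in> ideal_gen ?R" if a: "a \<in> A" and "b \<in> ideal_gen B" for a b
  proof -
    have "is_ideal {b. a * b \<in> ideal_gen ?R}"
    proof (rule is_idealI)
      fix r x assume "x \<in> {b. a * b \<in> ideal_gen ?R}"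
      then have "r * (a * x) \<in> ideal_gen ?R" by (auto intro: ideal_gen_mult)
      then show "r * x \<in> {b. a * b \<in> ideal_gen ?R}" by (simp add: mult.left_commute)
    qed (simp_all add: ideal_gen_zero distrib_left ideal_gen_add)
    moreover have "B \<subseteq> {b. a * b \<in> ideal_gen ?R}" using a by (auto intro!: ideal_gen_base)
    ultimately show ?thesis using ideal_gen_minimal that(2) by blast
  qed
  have "a * b \<in> ideal_gen ?R" if "a \<in> ideal_gen A" and b: "b \<in> ideal_gen B" for a b
  proof -
    have "is_ideal {a. a * b \<in> ideal_gen ?R}"
      by (rule is_idealI) (simp_all add: ideal_gen_zero distrib_right ideal_gen_add mult.assoc ideal_gen_mult)
    moreover have "A \<subseteq> {a. a * b \<in> ideal_gen ?R}" using 1 b by auto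
    ultimately show ?thesis using ideal_gen_minimal that(1) by blast
  qed
  then show "ideal_gen ?L \<subseteq> ideal_gen ?R" by (intro ideal_gen_minimal is_ideal_ideal_gen) auto
  show "ideal_gen ?R \<subseteq> ideal_gen ?L" by (intro ideal_gen_mono) (auto intro: ideal_gen_base)
qed

lemma is_ideal_ideal_power: "is_ideal (ideal_power J i)"
  by (cases i) (auto simp: is_ideal_ideal_gen ring_module.subspace_UNIV)

text \<open>This makes the Rees algebra closed under multiplication.\<close>

lemma ideal_power_mult_mem:
  "a \<in> ideal_power J i \<Longrightarrow> b \<in> ideal_power J j \<Longrightarrow> a * b \<in> ideal_power J (i + j)"
proof (induction i arbitrary: a)
  case 0
  then show ?case by (simp add: ring_module.subspace_scale is_ideal_ideal_power)
next
  case (Suc i)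
  let ?H = "{a. a * b \<in> ideal_power J (Suc i + j)}"
  have "is_ideal ?H"
  proof (rule is_idealI)
    note H = is_ideal_ideal_power[of J "Suc i + j"]
    show "0 \<in> ?H" using ring_module.subspace_0[OF H] by simp
    show "x + y \<in> ?H" if "x \<in> ?H" "y \<in> ?H" for x y
      using ring_module.subspace_add[OF H, of "x * b" "y * b"] that by (simp add: distrib_right)
    show "r * x \<in> ?H" if "x \<in> ?H" for r x
      using ring_module.subspace_scale[OF H, of "x * b" r] that by (simp add: mult.assoc)
  qed
  moreover have "{x * y | x y. x \<in> J \<and> y \<in> ideal_power J i} \<subseteq> ?H"
    using Suc.IH Suc.prems(2) by (fastforce simp: mult.assoc intro!: ideal_gen_base)
  ultimately have "ideal_power J (Suc i) \<subseteq> ?H" unfolding ideal_power.simps by (rule ideal_gen_minimal[rotated])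
  then show ?case using Suc.prems(1) by blast
qed

text \<open>Replacing each \<open>M x\<close> by the chosen representative of its class changes the
  sum by an element of \<open>H\<close>, and the sum over representatives vanishes class by class.
  Relations of the fiber cone and of the Rees algebra are both reduced to differences of two terms
  in this way.\<close>

lemma class_sum_mem_ideal:
  fixes s M :: "'b \<Rightarrow> 'a::comm_ring_1"
  assumes H: "is_ideal H" and fin: "finite A"
    and zero: "\<And>y. (\<Sum>x\<in>{x\<in>A. f x = y}. s x) = 0"
    and diff: "\<And>x y. x \<in> A \<Longrightarrow> y \<in> A \<Longrightarrow> f x = f y \<Longrightarrow> M x - M y \<in> H"
  shows "(\<Sum>x\<in>A. s x * M x) \<in> H"
proof -
  define r where "r y = (SOME x. x \<in> A \<and> f x = y)" for y
  have r: "r (f x) \<in> A \<and> f (r (f x)) = f x" if "x \<in> A" for x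
    unfolding r_def by (rule someI[of _ x]) (use that in simp)
  have "(\<Sum>x\<in>A. s x * M (r (f x))) = (\<Sum>y\<in>f ` A. \<Sum>x\<in>{x\<in>A. f x = y}. s x * M (r (f x)))"
    using fin by (rule sum.image_gen)
  also have "\<dots> = (\<Sum>y\<in>f ` A. \<Sum>x\<in>{x\<in>A. f x = y}. s x * M (r y))"
    by (intro sum.cong refl) auto
  also have "\<dots> = 0" by (simp add: zero flip: sum_distrib_right)
  finally have "(\<Sum>x\<in>A. s x * M x) = (\<Sum>x\<in>A. s x * (M x - M (r (f x))))"
    by (simp add: right_diff_distrib sum_subtractf)
  also have "\<dots> \<in> H"
    using r diff by (intro ring_module.subspace_sum[OF H] ring_module.subspace_scale[OF H]) auto
  finally show ?thesis .
qed

section \<open>Connectivity of exponents of Veronese type\<close>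

lemma size_eq_subseteq_mset: "a \<subseteq># b \<Longrightarrow> size b \<le> size a \<Longrightarrow> a = (b :: 'a multiset)"
  by (metis leD mset_subset_size subset_mset.le_imp_less_or_eq)

lemma exists_greater_count:
  assumes "size a = size b" "count a i < count b i"
  shows "\<exists>l. count b l < count (a :: 'a multiset) l"
proof (rule ccontr)
  assume "\<not> ?thesis"
  then have "a \<subseteq># b" by (auto simp: subseteq_mset_def not_less)
  then show False using size_eq_subseteq_mset[of a b] assms by auto
qed

definition veronese :: "nat \<Rightarrow> nat \<Rightarrow> nat \<Rightarrow> nat multiset set" where
  "veronese t e m = {a. set_mset a \<subseteq> {1..t} \<and> size a = e \<and> (\<forall>i. count a i \<le> m)}"

lemma finite_veronese: "finite (veronese t e m)"
proof (rule finite_subset)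
  show "veronese t e m \<subseteq> mset ` {xs. set xs \<subseteq> {1..t} \<and> length xs = e}"
  proof
    fix a assume "a \<in> veronese t e m"
    moreover obtain xs where "a = mset xs" using ex_mset by metis
    ultimately show "a \<in> mset ` {xs. set xs \<subseteq> {1..t} \<and> length xs = e}"
      by (auto simp: veronese_def)
  qed
qed (simp add: finite_lists_length_eq)

text \<open>The \<open>T\<close>-variables are indexed by the type \<open>'m\<close>;
  \<open>u\<close> attaches to each of them the exponent of its generator. Surjectivity supplies a
  variable for every exponent that an exchange produces.\<close>

locale veronese_bijection =
  fixes u :: "'m \<Rightarrow> nat multiset" and t e m :: nat
  assumes bij: "bij_betw u UNIV (veronese t e m)"
begin

lemma u_mem: "u x \<in> veronese t e m"
  using bij by (auto simp: bij_betw_def)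

lemma u_inj: "u x = u y \<Longrightarrow> x = y"
  using bij by (auto simp: bij_betw_def inj_def)

lemma u_surj: "a \<in> veronese t e m \<Longrightarrow> \<exists>x. u x = a"
  using bij by (auto simp: bij_betw_def) (metis imageE)

lemma size_u: "size (u x) = e" and count_u_le: "count (u x) i \<le> m" and set_u: "set_mset (u x) \<subseteq> {1..t}"
  using u_mem[of x] by (auto simp: veronese_def)

text \<open>The exponent of the product of the generators that correspond to the factors of
  \<open>\<alpha>\<close>.\<close>

definition weight :: "'m multiset \<Rightarrow> nat multiset" where
  "weight \<alpha> = (\<Sum>x\<in>#\<alpha>. u x)"

lemma weight_simps [simp]:
  "weight {#} = {#}" "weight (add_mset x \<alpha>) = u x + weight \<alpha>" "weight (\<alpha> + \<beta>) = weight \<alpha> + weight \<beta>"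
  by (simp_all add: weight_def)

lemma size_weight: "size (weight \<alpha>) = size \<alpha> * e"
  by (induction \<alpha>) (simp_all add: size_u)

lemma set_weight: "set_mset (weight \<alpha>) \<subseteq> {1..t}"
  using set_u by (induction \<alpha>) auto

lemma count_weight_le: "count (weight \<alpha>) i \<le> size \<alpha> * m"
  by (induction \<alpha>) (simp_all add: count_u_le add_mono)

lemma exists_count_pos: "0 < count (weight \<alpha>) i \<Longrightarrow> \<exists>x\<in>#\<alpha>. 0 < count (u x) i"
  by (induction \<alpha>) auto

text \<open>If no factor had room at \<open>i\<close>, all exponents there would equal the cap
  \<open>m\<close>.\<close>

lemma exists_count_less: "count (weight \<alpha>) i < size \<alpha> * m \<Longrightarrow> \<exists>x\<in>#\<alpha>. count (u x) i < m"
proof (induction \<alpha>)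
  case (add x \<alpha>)
  then show ?case using count_u_le[of x i] by (cases "count (u x) i = m") auto
qed simp

text \<open>
  Multisets of elements of \<^typ>\<open>'m\<close> stand for monomials in the \<open>T\<close>-variables. A swap is a
  multiple of a quadratic binomial relation \<open>T\<^sub>x T\<^sub>y = T\<^sub>z T\<^sub>w\<close>.
\<close>

definition swap :: "'m multiset \<Rightarrow> 'm multiset \<Rightarrow> bool" where
  "swap \<alpha> \<beta> \<longleftrightarrow> (\<exists>\<gamma> x y z w. u x + u y = u z + u w \<and> \<alpha> = \<gamma> + {#x, y#} \<and> \<beta> = \<gamma> + {#z, w#})"

abbreviation swaps :: "'m multiset \<Rightarrow> 'm multiset \<Rightarrow> bool" where
  "swaps \<equiv> swap\<^sup>*\<^sup>*"

lemma swap_weight: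
  assumes "swap \<alpha> \<beta>" shows "weight \<beta> = weight \<alpha>"
proof -
  obtain \<gamma> x y z w where eq: "u x + u y = u z + u w" and \<alpha>: "\<alpha> = \<gamma> + {#x, y#}" and \<beta>: "\<beta> = \<gamma> + {#z, w#}"
    using assms unfolding swap_def by blast
  have "weight \<beta> = weight \<gamma> + (u z + u w)" "weight \<alpha> = weight \<gamma> + (u x + u y)"
    unfolding \<alpha> \<beta> by (simp_all add: ac_simps)
  then show ?thesis using eq by simp
qed

lemma swaps_weight: "swaps \<alpha> \<beta> \<Longrightarrow> weight \<beta> = weight \<alpha>"
  by (induction rule: rtranclp_induct) (auto simp: swap_weight)

lemma swaps_size: "swaps \<alpha> \<beta> \<Longrightarrow> size \<beta> = size \<alpha>"
  by (induction rule: rtranclp_induct) (auto simp: swap_def)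

lemma swaps_add: "swaps \<alpha> \<beta> \<Longrightarrow> swaps (\<gamma> + \<alpha>) (\<gamma> + \<beta>)"
proof (induction rule: rtranclp_induct)
  case (step \<beta> \<beta>')
  then obtain \<delta> x y z w where "u x + u y = u z + u w" "\<beta> = \<delta> + {#x, y#}" "\<beta>' = \<delta> + {#z, w#}"
    unfolding swap_def by blast
  then have "swap (\<gamma> + \<beta>) (\<gamma> + \<beta>')"
    unfolding swap_def by (intro exI[of _ "\<gamma> + \<delta>"] exI[of _ x] exI[of _ y] exI[of _ z] exI[of _ w]) simp
  then show ?case using step.IH by (rule rtranclp.rtrancl_into_rtrancl[rotated])
qed simp

text \<open>One unit of \<open>i\<close> passes from \<open>u y\<close> to \<open>u x\<close> and
  one unit of \<open>l\<close> back, so the sizes and the sum are kept; the two bounds by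
  \<open>m\<close> leave room for the incoming units.\<close>

lemma swaps_exchange:
  assumes "i \<noteq> l" "count (u x) i < m" "0 < count (u x) l" "0 < count (u y) i" "count (u y) l < m"
  shows "\<exists>x' y'. u x' = add_mset i (u x) - {#l#} \<and> u y' = add_mset l (u y) - {#i#} \<and>
           swaps (\<gamma> + {#x, y#}) (\<gamma> + {#x', y'#})"
proof -
  have l: "l \<in># u x" and i: "i \<in># u y" using assms by auto
  have "add_mset i (u x) - {#l#} \<in> veronese t e m"
    using u_mem[of x] l i set_u[of y] assms size_Suc_Diff1[OF l]
    by (auto simp: veronese_def size_Diff_singleton le_diff_conv le_SucI dest: in_diffD)
  moreover have "add_mset l (u y) - {#i#} \<in> veronese t e m"
    using u_mem[of y] l i set_u[of x] assms size_Suc_Diff1[OF i]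
    by (auto simp: veronese_def size_Diff_singleton le_diff_conv le_SucI dest: in_diffD)
  ultimately obtain x' y' where xy: "u x' = add_mset i (u x) - {#l#}" "u y' = add_mset l (u y) - {#i#}"
    using u_surj by metis
  have "u x + u y = u x' + u y'"
    unfolding xy using assms by (intro multiset_eqI) auto
  then have "swap (\<gamma> + {#x, y#}) (\<gamma> + {#x', y'#})" unfolding swap_def by blast
  then show ?thesis using xy by blast
qed

text \<open>Room for \<open>i\<close> and supply of \<open>j\<close> may sit in different factors,
  and both are wanted in one. In the bad case \<open>u y\<close> is full at \<open>i\<close> and
  \<open>u x\<close> lacks \<open>j\<close>. Then a unit of \<open>i\<close> moves from
  \<open>u y\<close> to \<open>u x\<close> in return for some \<open>l\<close>, after which the
  changed \<open>u y\<close> has room and still contains \<open>j\<close>.\<close>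

lemma swaps_merge:
  assumes "x \<in># \<alpha>" "y \<in># \<alpha>" and x: "count (u x) i < m" and y: "0 < count (u y) j" and "i \<noteq> j"
  shows "\<exists>\<alpha>' z. swaps \<alpha> \<alpha>' \<and> z \<in># \<alpha>' \<and> count (u z) i < m \<and> 0 < count (u z) j"
proof (cases "count (u y) i < m \<or> 0 < count (u x) j")
  case True
  then show ?thesis using assms by blast
next
  case False
  then have yi: "count (u y) i = m" and xj: "count (u x) j = 0"
    using count_u_le[of y i] by linarith+
  have "x \<noteq> y" using xj y by (metis less_irrefl)
  then obtain \<gamma> where \<gamma>: "\<alpha> = \<gamma> + {#x, y#}"
    using assms(1,2) by (metis add.commute add_mset_add_single insert_noteq_member mset_add union_mset_add_mset_left)
  \<comment> \<open>The sizes agree and \<open>u y\<close> exceeds \<open>u x\<close> at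
    \<open>i\<close>, so it falls short elsewhere. This \<open>l\<close> differs from
    \<open>j\<close>, which \<open>u x\<close> lacks.\<close>
  have "\<exists>l. count (u y) l < count (u x) l"
    using x yi by (intro exists_greater_count[of _ _ i]) (auto simp: size_u)
  then obtain l where l: "count (u y) l < count (u x) l" by blast
  then have "i \<noteq> l" "l \<noteq> j" using x yi xj by auto
  have pos: "count (u y) l < m" "0 < count (u x) l" "0 < count (u y) i"
    using l count_u_le[of x l] yi x by linarith+
  then obtain x' y' where "u y' = add_mset l (u y) - {#i#}" "swaps \<alpha> (\<gamma> + {#x', y'#})"
    using swaps_exchange[of i l x y \<gamma>] pos \<open>i \<noteq> l\<close> x \<gamma> by blast
  moreover from this have "count (u y') i < m" "0 < count (u y') j"
    using \<open>i \<noteq> l\<close> \<open>l \<noteq> j\<close> \<open>i \<noteq> j\<close> yi x y by auto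
  ultimately show ?thesis
    by (intro exI[of _ "\<gamma> + {#x', y'#}"] exI[of _ y']) simp
qed

text \<open>The factor \<open>a\<close> is turned into \<open>b\<close> unit by unit, the measure
  being the part of \<open>u b\<close> missing from \<open>u a\<close>. The other factors supply the
  needed \<open>i\<close> and absorb the surplus \<open>l\<close>: by comparison of total weights
  they contain \<open>i\<close>, and at \<open>l\<close> they weigh less than
  \<open>\<beta>\<close>, which has equally many factors, so one of them is below the cap
  there.\<close>

lemma swaps_to_contain:
  assumes "a \<in># \<alpha>" "size \<alpha> = Suc (size \<beta>)" "weight \<alpha> = u b + weight \<beta>"
  shows "\<exists>\<alpha>'. swaps \<alpha> (add_mset b \<alpha>')"
  using assms
proof (induction "size (u b - u a)" arbitrary: a \<alpha> rule: less_induct)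
  case less
  obtain \<alpha>0 where \<alpha>: "\<alpha> = add_mset a \<alpha>0" using less.prems(1) by (metis mset_add)
  show ?case
  proof (cases "u b \<subseteq># u a")
    case True
    then have "b = a" by (intro u_inj size_eq_subseteq_mset) (auto simp: size_u)
    then show ?thesis using \<alpha> by blast
  next
    case False
    then obtain i where i: "count (u a) i < count (u b) i" by (auto simp: subseteq_mset_def not_le)
    have "\<exists>l. count (u b) l < count (u a) l"
      using i by (intro exists_greater_count[of _ _ i]) (auto simp: size_u)
    then obtain l where l: "count (u b) l < count (u a) l" by blast
    then have "i \<noteq> l" using i by auto
    have eq: "count (u a) k + count (weight \<alpha>0) k = count (u b) k + count (weight \<beta>) k" for k
      using less.prems(3) \<alpha> by (metis count_union weight_simps(2))
    have "\<exists>y\<in>#\<alpha>0. 0 < count (u y) i"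
      using eq[of i] i by (intro exists_count_pos) linarith
    moreover have "\<exists>x\<in>#\<alpha>0. count (u x) l < m"
      using eq[of l] l count_weight_le[of \<beta> l] less.prems(2) \<alpha> by (intro exists_count_less) simp
    ultimately obtain \<alpha>1 z where z: "swaps \<alpha>0 \<alpha>1" "z \<in># \<alpha>1" "count (u z) l < m" "0 < count (u z) i"
      using swaps_merge \<open>i \<noteq> l\<close> by metis
    obtain \<gamma> where \<gamma>: "\<alpha>1 = add_mset z \<gamma>" using z by (metis mset_add)
    have "count (u a) i < m" using i count_u_le[of b i] by simp
    moreover have "0 < count (u a) l" using l by linarith
    ultimately obtain a' z' where a': "u a' = add_mset i (u a) - {#l#}" "swaps (\<gamma> + {#a, z#}) (\<gamma> + {#a', z'#})"
      using swaps_exchange[of i l a z \<gamma>] z(3,4) \<open>i \<noteq> l\<close> by blast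
    have "swaps \<alpha> (\<gamma> + {#a, z#})"
      using swaps_add[OF z(1), of "{#a#}"] by (simp add: \<alpha> \<gamma> add_mset_commute)
    then have sw: "swaps \<alpha> (\<gamma> + {#a', z'#})" using a'(2) by (rule rtranclp_trans)
    have "u b - u a' \<subset># u b - u a"
    proof (rule subset_mset.le_neq_trans)
      show "u b - u a' \<subseteq># u b - u a"
      proof (rule mset_subset_eqI)
        fix k show "count (u b - u a') k \<le> count (u b - u a) k"
          using l by (cases "k = l") (auto simp: a'(1))
      qed
      have "count (u b - u a') i \<noteq> count (u b - u a) i"
        using i \<open>i \<noteq> l\<close> by (simp add: a'(1))
      then show "u b - u a' \<noteq> u b - u a" by metis
    qed
    then have "size (u b - u a') < size (u b - u a)" by (rule mset_subset_size)
    then obtain \<alpha>' where "swaps (\<gamma> + {#a', z'#}) (add_mset b \<alpha>')"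
      using less.hyps[of a' "\<gamma> + {#a', z'#}"] swaps_weight[OF sw] swaps_size[OF sw] less.prems by auto
    then show ?thesis using sw by (meson rtranclp_trans)
  qed
qed

text \<open>Once a factor \<open>b\<close> of \<open>\<beta>\<close> has been produced, it can be
  split off on both sides. Algebraically this says that the toric ideal of an algebra of Veronese
  type is generated by quadrics.\<close>

lemma swaps_if_weight_eq:
  "size \<alpha> = size \<beta> \<Longrightarrow> weight \<alpha> = weight \<beta> \<Longrightarrow> swaps \<alpha> \<beta>"
proof (induction \<beta> arbitrary: \<alpha>)
  case (add b \<beta>)
  then obtain a where "a \<in># \<alpha>" by (metis size_eq_Suc_imp_elem size_add_mset)
  then obtain \<alpha>' where \<alpha>': "swaps \<alpha> (add_mset b \<alpha>')"
    using swaps_to_contain[of a \<alpha> \<beta> b] add.prems by auto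
  have "swaps \<alpha>' \<beta>"
    using add.prems swaps_size[OF \<alpha>'] swaps_weight[OF \<alpha>'] by (intro add.IH) auto
  then show ?case using \<alpha>' swaps_add[of \<alpha>' \<beta> "{#b#}"] by simp
qed simp

text \<open>
  A bounded move is either a swap or a multiple of a linear relation
  \<open>F\<^bsup>c - v - u x\<^esup> T\<^sub>x = F\<^bsup>c - v - u y\<^esup> T\<^sub>y\<close>.
\<close>

definition move :: "nat multiset \<Rightarrow> 'm multiset \<Rightarrow> 'm multiset \<Rightarrow> bool" where
  "move c \<alpha> \<beta> \<longleftrightarrow> swap \<alpha> \<beta> \<or>
     (\<exists>\<gamma> x y. \<alpha> = add_mset x \<gamma> \<and> \<beta> = add_mset y \<gamma> \<and> weight \<alpha> \<subseteq># c \<and> weight \<beta> \<subseteq># c)"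

lemma swaps_moves: "swaps \<alpha> \<beta> \<Longrightarrow> (move c)\<^sup>*\<^sup>* \<alpha> \<beta>"
  by (rule rtranclp_mono[THEN predicate2D, rotated]) (auto simp: move_def)

text \<open>The measure is the part of \<open>weight \<beta>\<close> missing from
  \<open>weight \<alpha>\<close>. Swaps bring room for a missing \<open>i\<close> and supply of a
  surplus \<open>j\<close> into one factor \<open>z\<close>; replacing \<open>j\<close> by
  \<open>i\<close> there is a linear relation. The new weight stays below \<open>c\<close>, being at
  most that of \<open>\<beta>\<close> at \<open>i\<close> and at most that of
  \<open>\<alpha>\<close> elsewhere.\<close>

lemma moves_if_weight_le:
  "size \<alpha> = size \<beta> \<Longrightarrow> weight \<alpha> \<subseteq># c \<Longrightarrow> weight \<beta> \<subseteq># c \<Longrightarrow> (move c)\<^sup>*\<^sup>* \<alpha> \<beta>"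
proof (induction "size (weight \<beta> - weight \<alpha>)" arbitrary: \<alpha> rule: less_induct)
  case less
  have sz: "size (weight \<alpha>) = size (weight \<beta>)" using less.prems by (simp add: size_weight)
  show ?case
  proof (cases "weight \<beta> \<subseteq># weight \<alpha>")
    case True
    then have "weight \<beta> = weight \<alpha>" using sz by (intro size_eq_subseteq_mset) auto
    then show ?thesis using less.prems by (intro swaps_moves swaps_if_weight_eq) auto
  next
    case False
    then obtain i where i: "count (weight \<alpha>) i < count (weight \<beta>) i"
      by (auto simp: subseteq_mset_def not_le)
    obtain j where j: "count (weight \<beta>) j < count (weight \<alpha>) j"
      using exists_greater_count[OF sz i] by blast
    have "i \<noteq> j" using i j by auto
    have "\<exists>x\<in>#\<alpha>. count (u x) i < m"
      using i count_weight_le[of \<beta> i] less.prems(1) by (intro exists_count_less) simp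
    moreover have "\<exists>y\<in>#\<alpha>. 0 < count (u y) j"
      using j by (intro exists_count_pos) linarith
    ultimately obtain \<alpha>1 z where z: "swaps \<alpha> \<alpha>1" "z \<in># \<alpha>1" "count (u z) i < m" "0 < count (u z) j"
      using swaps_merge \<open>i \<noteq> j\<close> by metis
    obtain \<gamma> where \<gamma>: "\<alpha>1 = add_mset z \<gamma>" using z by (metis mset_add)
    have "i \<in># weight \<beta>" using i by (metis count_greater_zero_iff gr_zeroI not_less_zero)
    then have "i \<in> {1..t}" using set_weight by blast
    moreover have zj: "j \<in># u z" using z by simp
    ultimately have "add_mset i (u z) - {#j#} \<in> veronese t e m"
      using u_mem[of z] z size_Suc_Diff1[OF zj] \<open>i \<noteq> j\<close>
      by (auto simp: veronese_def size_Diff_singleton le_diff_conv le_SucI dest: in_diffD)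
    then obtain z' where z': "u z' = add_mset i (u z) - {#j#}" using u_surj by blast
    have w: "weight (add_mset z \<gamma>) = weight \<alpha>" using swaps_weight[OF z(1)] \<gamma> by simp
    have w': "weight (add_mset z' \<gamma>) = add_mset i (weight \<alpha>) - {#j#}"
    proof (rule multiset_eqI)
      fix k
      have "count (u z) k + count (weight \<gamma>) k = count (weight \<alpha>) k"
        using w by (metis count_union weight_simps(2))
      then show "count (weight (add_mset z' \<gamma>)) k = count (add_mset i (weight \<alpha>) - {#j#}) k"
        using z(4) \<open>i \<noteq> j\<close> by (auto simp: z')
    qed
    have w'c: "weight (add_mset z' \<gamma>) \<subseteq># c"
    proof (rule mset_subset_eqI)
      fix k
      have "count (weight \<alpha>) k \<le> count c k" "count (weight \<beta>) k \<le> count c k"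
        using less.prems(2,3) by (auto simp: subseteq_mset_def)
      then show "count (weight (add_mset z' \<gamma>)) k \<le> count c k"
        unfolding w' using i by auto
    qed
    then have "move c \<alpha>1 (add_mset z' \<gamma>)"
      unfolding move_def using \<gamma> w less.prems(2) by auto
    then have mv: "(move c)\<^sup>*\<^sup>* \<alpha> (add_mset z' \<gamma>)"
      using swaps_moves[OF z(1), of c] by auto
    have "weight \<beta> - weight (add_mset z' \<gamma>) \<subset># weight \<beta> - weight \<alpha>"
    proof (rule subset_mset.le_neq_trans)
      show "weight \<beta> - weight (add_mset z' \<gamma>) \<subseteq># weight \<beta> - weight \<alpha>"
      proof (rule mset_subset_eqI)
        fix k show "count (weight \<beta> - weight (add_mset z' \<gamma>)) k \<le> count (weight \<beta> - weight \<alpha>) k"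
          unfolding w' using j by (cases "k = j") auto
      qed
      have "count (weight \<beta> - weight (add_mset z' \<gamma>)) i \<noteq> count (weight \<beta> - weight \<alpha>) i"
        unfolding w' using i \<open>i \<noteq> j\<close> by simp
      then show "weight \<beta> - weight (add_mset z' \<gamma>) \<noteq> weight \<beta> - weight \<alpha>" by metis
    qed
    then have "size (weight \<beta> - weight (add_mset z' \<gamma>)) < size (weight \<beta> - weight \<alpha>)"
      by (rule mset_subset_size)
    then have "(move c)\<^sup>*\<^sup>* (add_mset z' \<gamma>) \<beta>"
      using less.hyps less.prems w'c swaps_size[OF z(1)] \<gamma> by simp
    then show ?thesis using mv by (rule rtranclp_trans[rotated])
  qed
qed

end

section \<open>Expansions in powers of a regular sequence\<close>

definition fmon :: "(nat \<Rightarrow> 'a::comm_ring_1) \<Rightarrow> nat multiset \<Rightarrow> 'a" where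
  "fmon F a = (\<Prod>i\<in>#a. F i)"

lemma fmon_simps [simp]:
  "fmon F {#} = 1" "fmon F (add_mset i a) = F i * fmon F a" "fmon F (a + b) = fmon F a * fmon F b"
  by (simp_all add: fmon_def)

definition expansion_sum :: "(nat \<Rightarrow> 'a::comm_ring_1) \<Rightarrow> (nat multiset \<Rightarrow>\<^sub>0 'a) \<Rightarrow> 'a" where
  "expansion_sum F w = (\<Sum>c\<in>Poly_Mapping.keys w. Poly_Mapping.lookup w c * fmon F c)"

lemma expansion_sum_superset:
  "finite C \<Longrightarrow> Poly_Mapping.keys w \<subseteq> C \<Longrightarrow>
     expansion_sum F w = (\<Sum>c\<in>C. Poly_Mapping.lookup w c * fmon F c)"
  unfolding expansion_sum_def by (rule sum.mono_neutral_left) (auto simp: in_keys_iff)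

lemma expansion_sum_add: "expansion_sum F (v + w) = expansion_sum F v + expansion_sum F w"
  unfolding expansion_sum_def by (rule setsum_keys_plus_distrib) (simp_all add: distrib_right)

text \<open>The effect on an expansion of multiplying by \<open>fmon F a\<close>.\<close>

definition shift :: "nat multiset \<Rightarrow> (nat multiset \<Rightarrow>\<^sub>0 'a::zero) \<Rightarrow> nat multiset \<Rightarrow>\<^sub>0 'a" where
  "shift a w = Abs_poly_mapping (\<lambda>c. if a \<subseteq># c then Poly_Mapping.lookup w (c - a) else 0)"

lemma lookup_shift:
  "Poly_Mapping.lookup (shift a w) c = (if a \<subseteq># c then Poly_Mapping.lookup w (c - a) else 0)"
proof -
  have "{c. (if a \<subseteq># c then Poly_Mapping.lookup w (c - a) else 0) \<noteq> 0} \<subseteq> (+) a ` Poly_Mapping.keys w"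
  proof
    fix c assume "c \<in> {c. (if a \<subseteq># c then Poly_Mapping.lookup w (c - a) else 0) \<noteq> 0}"
    then have "c = a + (c - a)" "c - a \<in> Poly_Mapping.keys w" by (auto simp: in_keys_iff split: if_splits)
    then show "c \<in> (+) a ` Poly_Mapping.keys w" by (metis imageI)
  qed
  then have "finite {c. (if a \<subseteq># c then Poly_Mapping.lookup w (c - a) else 0) \<noteq> 0}"
    by (rule finite_subset) simp
  then show ?thesis unfolding shift_def by simp
qed

lemma keys_shift: "Poly_Mapping.keys (shift a w) = (+) a ` Poly_Mapping.keys w"
proof (intro equalityI subsetI)
  fix c assume "c \<in> Poly_Mapping.keys (shift a w)"
  then have "c = a + (c - a)" "c - a \<in> Poly_Mapping.keys w"
    by (auto simp: in_keys_iff lookup_shift split: if_splits)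
  then show "c \<in> (+) a ` Poly_Mapping.keys w" by (metis imageI)
qed (auto simp: in_keys_iff lookup_shift)

lemma expansion_sum_shift: "expansion_sum F (shift a w) = expansion_sum F w * fmon F a"
  unfolding expansion_sum_def sum_distrib_right
  by (simp add: keys_shift sum.reindex lookup_shift mult_ac)

text \<open>
  The induction runs downwards in \<open>i\<close>: terms not involving \<open>F\<^sub>i\<^sub>+\<^sub>1\<close> vanish by working modulo
  \<open>F\<^sub>1, \<dots>, F\<^sub>i\<^sub>+\<^sub>1\<close>, and \<open>F\<^sub>i\<^sub>+\<^sub>1\<close> cancels from the remaining ones.
\<close>

lemma regular_sequence_independent:
  fixes F :: "nat \<Rightarrow> 'a::comm_ring_1"
  assumes reg: "regular_sequence F t" and W: "W \<inter> ideal_gen (F ` {1..t}) \<subseteq> {0}" and "i \<le> t"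
    and "finite C" "\<And>c. c \<in> C \<Longrightarrow> w c \<in> W" "\<And>c. c \<in> C \<Longrightarrow> set_mset c \<subseteq> {i<..t}"
    and "(\<Sum>c\<in>C. w c * fmon F c) \<in> ideal_gen (F ` {1..i})"
  shows "\<forall>c\<in>C. w c = 0"
  using assms(3-)
proof (induction i arbitrary: C w rule: inc_induct)
  case base
  show ?case
  proof
    fix c assume "c \<in> C"
    then have "C = {{#}}" "c = {#}" using base.prems(3) by fastforce+
    then show "w c = 0" using base.prems W by auto
  qed
next
  case (step i)
  define j where "j = Suc i"
  have j: "j \<in> {1..t}" "{1..<j} = {1..i}" using step.hyps by (auto simp: j_def)
  \<comment> \<open>\<open>n\<close> is a strict bound for the exponent of \<open>F j\<close>.
    Dividing the terms that contain \<open>F j\<close> by it lowers the bound, and for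
    \<open>n = 0\<close> the set \<open>C\<close> is empty.\<close>
  have "\<forall>c\<in>C. w c = 0"
    if "finite C" "\<And>c. c \<in> C \<Longrightarrow> w c \<in> W" "\<And>c. c \<in> C \<Longrightarrow> set_mset c \<subseteq> {i<..t}"
      "(\<Sum>c\<in>C. w c * fmon F c) \<in> ideal_gen (F ` {1..i})" "\<And>c. c \<in> C \<Longrightarrow> count c j < n" for n C w
    using that
  proof (induction n arbitrary: C w)
    case (Suc n)
    define C0 where "C0 = {c\<in>C. j \<notin># c}"
    define C1 where "C1 = {c\<in>C. j \<in># c}"
    define D where "D = (\<lambda>c. c - {#j#}) ` C1"
    define X where "X = (\<Sum>c\<in>D. w (add_mset j c) * fmon F c)"
    have fin: "finite C0" "finite C1" "finite D" using Suc.prems(1) by (auto simp: C0_def C1_def D_def)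
    have inj: "inj_on (\<lambda>c. c - {#j#}) C1"
      by (rule inj_onI) (metis (no_types, lifting) C1_def insert_DiffM mem_Collect_eq)
    have X: "(\<Sum>c\<in>C1. w c * fmon F c) = F j * X"
    proof -
      have "(\<Sum>c\<in>C1. w c * fmon F c) = (\<Sum>c\<in>C1. F j * (w (add_mset j (c - {#j#})) * fmon F (c - {#j#})))"
      proof (rule sum.cong)
        fix c assume "c \<in> C1"
        then have "c = add_mset j (c - {#j#})" by (simp add: C1_def)
        then show "w c * fmon F c = F j * (w (add_mset j (c - {#j#})) * fmon F (c - {#j#}))"
          by (metis fmon_simps(2) mult.left_commute)
      qed simp
      then show ?thesis by (simp add: X_def D_def sum.reindex[OF inj] sum_distrib_left)
    qed
    have "(\<Sum>c\<in>C. w c * fmon F c) = (\<Sum>c\<in>C0. w c * fmon F c) + (\<Sum>c\<in>C1. w c * fmon F c)"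
      using Suc.prems(1) by (subst sum.union_disjoint[symmetric]) (auto simp: C0_def C1_def intro!: sum.cong)
    then have split: "(\<Sum>c\<in>C. w c * fmon F c) = (\<Sum>c\<in>C0. w c * fmon F c) + F j * X" using X by simp
    have "ideal_gen (F ` {1..i}) \<subseteq> ideal_gen (F ` {1..Suc i})"
      by (intro ideal_gen_mono) auto
    moreover have "X * F j \<in> ideal_gen (F ` {1..Suc i})"
      by (intro ideal_gen_mult ideal_gen_base) (auto simp: j_def)
    ultimately have "(\<Sum>c\<in>C. w c * fmon F c) - X * F j \<in> ideal_gen (F ` {1..Suc i})"
      using Suc.prems(4) by (intro ideal_gen_diff) auto
    then have "(\<Sum>c\<in>C0. w c * fmon F c) \<in> ideal_gen (F ` {1..Suc i})"
      using split by (simp add: mult.commute)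
    moreover have "set_mset c \<subseteq> {Suc i<..t}" if "c \<in> C0" for c
    proof
      fix k assume "k \<in># c"
      then have "k \<in> {i<..t}" "k \<noteq> j" using Suc.prems(3)[of c] that by (auto simp: C0_def)
      then show "k \<in> {Suc i<..t}" by (auto simp: j_def)
    qed
    ultimately have 0: "\<forall>c\<in>C0. w c = 0"
      using fin Suc.prems(2) by (intro step.IH) (auto simp: C0_def)
    then have "F j * X \<in> ideal_gen (F ` {1..<j})" using split Suc.prems(4) j by simp
    then have "X \<in> ideal_gen (F ` {1..i})" using reg j unfolding regular_sequence_def by metis
    moreover have "w (add_mset j c) \<in> W" "set_mset c \<subseteq> {i<..t}" "count c j < n" if "c \<in> D" for c
    proof -
      have "add_mset j c \<in> C" using that by (auto simp: D_def C1_def)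
      then show "w (add_mset j c) \<in> W" "set_mset c \<subseteq> {i<..t}" "count c j < n"
        using Suc.prems(2)[of "add_mset j c"] Suc.prems(3)[of "add_mset j c"] Suc.prems(5)[of "add_mset j c"] by auto
    qed
    ultimately have "\<forall>c\<in>D. w (add_mset j c) = 0"
      using fin(3) by (intro Suc.IH) (auto simp: X_def)
    then have 1: "\<forall>c\<in>C1. w c = 0" by (auto simp: D_def C1_def)
    show ?case using 0 1 by (auto simp: C0_def C1_def)
  qed auto
  moreover obtain n where "\<And>c. c \<in> C \<Longrightarrow> count c j < n"
  proof
    fix c assume "c \<in> C"
    then show "count c j < Suc (Max ((\<lambda>c. count c j) ` C))"
      using step.prems(1) by (simp add: le_imp_less_Suc)
  qed
  ultimately show ?case using step.prems by blast
qed

section \<open>Uniqueness of expansions\<close>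

definition expands :: "(nat \<Rightarrow> 'a::comm_ring_1) \<Rightarrow> nat \<Rightarrow> 'a set \<Rightarrow> 'a \<Rightarrow> (nat multiset \<Rightarrow>\<^sub>0 'a) \<Rightarrow> bool" where
  "expands F t W r w \<longleftrightarrow> (\<forall>c. Poly_Mapping.lookup w c \<in> W) \<and>
     (\<forall>c\<in>Poly_Mapping.keys w. set_mset c \<subseteq> {1..t}) \<and> r = expansion_sum F w"

text \<open>The coefficients form a subgroup, in general not closed under products: expansions can
  be added and shifted, but not multiplied coefficientwise.\<close>

definition closed_diff :: "'a::ab_group_add set \<Rightarrow> bool" where
  "closed_diff W \<longleftrightarrow> 0 \<in> W \<and> (\<forall>x\<in>W. \<forall>y\<in>W. x - y \<in> W)"

lemma closed_diff_add:
  assumes "closed_diff W" "x \<in> W" "y \<in> W" shows "x + y \<in> W"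
proof -
  have "x - (0 - y) \<in> W" using assms unfolding closed_diff_def by blast
  then show ?thesis by simp
qed

lemma expands_add:
  assumes W: "closed_diff W" and "expands F t W r v" "expands F t W s w"
  shows "expands F t W (r + s) (v + w)"
  unfolding expands_def
proof (intro conjI ballI allI)
  show "Poly_Mapping.lookup (v + w) c \<in> W" for c
    using assms(2,3) closed_diff_add[OF W] by (simp add: expands_def lookup_add)
  show "set_mset c \<subseteq> {1..t}" if "c \<in> Poly_Mapping.keys (v + w)" for c
    using assms(2,3) subsetD[OF keys_add that] unfolding expands_def by blast
  show "r + s = expansion_sum F (v + w)"
    using assms(2,3) by (simp add: expands_def expansion_sum_add)
qed

lemma expands_shift:
  assumes "closed_diff W" "expands F t W r w" "set_mset a \<subseteq> {1..t}"
  shows "expands F t W (r * fmon F a) (shift a w)"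
  using assms by (auto simp: expands_def expansion_sum_shift lookup_shift keys_shift closed_diff_def)

text \<open>The difference of the two expansions has coefficients in \<open>W\<close>, and
  \<open>regular_sequence_independent\<close> applies with \<open>i = 0\<close>, where the initial
  segment of the sequence is empty.\<close>

lemma expands_unique:
  assumes reg: "regular_sequence F t" and W: "W \<inter> ideal_gen (F ` {1..t}) \<subseteq> {0}" "closed_diff W"
    and v: "expands F t W r v" and w: "expands F t W r w"
  shows "v = w"
proof -
  define C where "C = Poly_Mapping.keys v \<union> Poly_Mapping.keys w"
  have C: "finite C" by (simp add: C_def)
  have set_C: "set_mset c \<subseteq> {0<..t}" if "c \<in> C" for c
  proof -
    have "set_mset c \<subseteq> {1..t}" using that v w unfolding C_def expands_def by blast
    then show ?thesis by (auto simp: Suc_le_eq)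
  qed
  have "(\<Sum>c\<in>C. Poly_Mapping.lookup v c * fmon F c) = (\<Sum>c\<in>C. Poly_Mapping.lookup w c * fmon F c)"
    using expansion_sum_superset[OF C, of v F] expansion_sum_superset[OF C, of w F] v w
    by (simp add: C_def expands_def)
  then have "(\<Sum>c\<in>C. (Poly_Mapping.lookup v c - Poly_Mapping.lookup w c) * fmon F c) = 0"
    by (simp add: left_diff_distrib sum_subtractf)
  then have "(\<Sum>c\<in>C. (Poly_Mapping.lookup v c - Poly_Mapping.lookup w c) * fmon F c) \<in> ideal_gen (F ` {1..0})"
    by (simp add: ideal_gen_zero)
  moreover have "Poly_Mapping.lookup v c - Poly_Mapping.lookup w c \<in> W" for c
    using W(2) v w by (auto simp: expands_def closed_diff_def)
  ultimately have eq: "\<forall>c\<in>C. Poly_Mapping.lookup v c - Poly_Mapping.lookup w c = 0"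
    using C set_C by (intro regular_sequence_independent[OF reg W(1), of 0]) auto
  show ?thesis
  proof (rule poly_mapping_eqI)
    fix c
    show "Poly_Mapping.lookup v c = Poly_Mapping.lookup w c"
    proof (cases "c \<in> C")
      case True
      then show ?thesis using eq by simp
    next
      case False
      then show ?thesis by (simp add: C_def in_keys_iff)
    qed
  qed
qed

section \<open>Graded components of polynomials and existence of expansions\<close>

lemma mdeg_add [simp]: "mdeg (a + b) = mdeg a + mdeg b"
  by (simp add: mdeg_def lookup_add sum.distrib)

lemma mdeg_zero [simp]: "mdeg 0 = 0"
  by (simp add: mdeg_def)

lemma mdeg_eq_0_iff: "mdeg a = 0 \<longleftrightarrow> a = 0"
  by (auto simp: mdeg_def intro: poly_mapping_eqI)

lemma poly_mapping_sum_single: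
  "p = (\<Sum>a\<in>Poly_Mapping.keys p. Poly_Mapping.single a (Poly_Mapping.lookup p a))"
proof (rule poly_mapping_eqI)
  fix a
  show "Poly_Mapping.lookup p a =
    Poly_Mapping.lookup (\<Sum>a\<in>Poly_Mapping.keys p. Poly_Mapping.single a (Poly_Mapping.lookup p a)) a"
    by (simp add: lookup_sum lookup_single when_def sum.delta' in_keys_iff)
qed

lemma single_sum: "Poly_Mapping.single k (\<Sum>x\<in>A. f x) = (\<Sum>x\<in>A. Poly_Mapping.single k (f x))"
  by (induction A rule: infinite_finite_induct) (simp_all add: single_add)

lemma lookup_single_zero_mult:
  "Poly_Mapping.lookup (Poly_Mapping.single 0 s * p) a = s * Poly_Mapping.lookup p (a :: 'b::monoid_add)"
  by (simp add: Poly_Mapping.map.rep_eq flip: mult_map_scale_conv_mult) (simp add: when_def)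

lemma homogeneous_mult:
  "homogeneous d p \<Longrightarrow> homogeneous e q \<Longrightarrow> homogeneous (d + e) (p * q)"
  using keys_mult[of p q] by (fastforce simp: homogeneous_def)

definition homogeneous_part :: "nat \<Rightarrow> ('x::finite, 'a::zero) mpoly \<Rightarrow> ('x, 'a) mpoly" where
  "homogeneous_part d p = Poly_Mapping.mapp (\<lambda>a v. if mdeg a = d then v else 0) p"

lemma lookup_homogeneous_part:
  "Poly_Mapping.lookup (homogeneous_part d p) a = (if mdeg a = d then Poly_Mapping.lookup p a else 0)"
  by (simp add: homogeneous_part_def lookup_mapp when_def in_keys_iff)

lemma keys_homogeneous_part: "Poly_Mapping.keys (homogeneous_part d p) \<subseteq> Poly_Mapping.keys p"
  by (auto simp: in_keys_iff lookup_homogeneous_part split: if_splits)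

lemma homogeneous_homogeneous_part: "homogeneous d (homogeneous_part d p)"
  by (auto simp: homogeneous_def in_keys_iff lookup_homogeneous_part split: if_splits)

lemma homogeneous_part_add:
  "homogeneous_part d (p + q) = homogeneous_part d p + homogeneous_part d (q :: ('x::finite, 'a::comm_monoid_add) mpoly)"
  by (rule poly_mapping_eqI) (simp add: lookup_homogeneous_part lookup_add)

lemma homogeneous_part_sum:
  "homogeneous_part d (\<Sum>i\<in>A. f i) = (\<Sum>i\<in>A. homogeneous_part d (f i :: ('x::finite, 'a::comm_monoid_add) mpoly))"
  by (rule poly_mapping_eqI) (simp add: lookup_homogeneous_part lookup_sum)

lemma homogeneous_part_homogeneous:
  "homogeneous e p \<Longrightarrow> homogeneous_part d p = (if d = e then p else 0)"
  by (rule poly_mapping_eqI) (auto simp: lookup_homogeneous_part homogeneous_def in_keys_iff)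

lemma sum_homogeneous_part:
  "p = (\<Sum>d\<in>mdeg ` Poly_Mapping.keys p. homogeneous_part d (p :: ('x::finite, 'a::comm_monoid_add) mpoly))"
proof (rule poly_mapping_eqI)
  fix a
  show "Poly_Mapping.lookup p a =
    Poly_Mapping.lookup (\<Sum>d\<in>mdeg ` Poly_Mapping.keys p. homogeneous_part d p) a"
    by (auto simp: lookup_sum lookup_homogeneous_part sum.delta' in_keys_iff)
qed

lemma homogeneous_part_mult:
  fixes f r :: "('x::finite, 'a::comm_semiring_0) mpoly"
  assumes f: "homogeneous d f"
  shows "homogeneous_part e (f * r) = (if d \<le> e then f * homogeneous_part (e - d) r else 0)"
proof -
  define D where "D = mdeg ` Poly_Mapping.keys r"
  have D: "finite D" by (simp add: D_def)
  have "f * r = (\<Sum>k\<in>D. f * homogeneous_part k r)"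
    using sum_homogeneous_part[of r] by (simp add: D_def flip: sum_distrib_left)
  then have "homogeneous_part e (f * r) = (\<Sum>k\<in>D. homogeneous_part e (f * homogeneous_part k r))"
    by (simp add: homogeneous_part_sum)
  also have "\<dots> = (\<Sum>k\<in>D. if e = d + k then f * homogeneous_part k r else 0)"
    by (intro sum.cong refl homogeneous_part_homogeneous homogeneous_mult f homogeneous_homogeneous_part)
  also have "\<dots> = (if d \<le> e then f * homogeneous_part (e - d) r else 0)"
  proof (cases "d \<le> e")
    case True
    then have "(\<Sum>k\<in>D. if e = d + k then f * homogeneous_part k r else 0) =
      (\<Sum>k\<in>D. if e - d = k then f * homogeneous_part k r else 0)"
      by (intro sum.cong) auto
    also have "\<dots> = (if e - d \<in> D then f * homogeneous_part (e - d) r else 0)"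
      using D by (simp add: sum.delta)
    also have "\<dots> = f * homogeneous_part (e - d) r"
    proof -
      have "homogeneous_part (e - d) r = 0" if "e - d \<notin> D"
      proof (rule poly_mapping_eqI)
        fix a show "Poly_Mapping.lookup (homogeneous_part (e - d) r) a = Poly_Mapping.lookup 0 a"
          using that unfolding D_def lookup_homogeneous_part by (metis imageI in_keys_iff lookup_zero)
      qed
      then show ?thesis by auto
    qed
    finally show ?thesis using True by simp
  next
    case False
    then show ?thesis by (auto intro!: sum.neutral)
  qed
  finally show ?thesis .
qed

text \<open>\<open>B\<close> is a maximal set of monomials linearly independent modulo
  \<open>Q\<close>, given by Zorn's lemma. A span of monomials is taken, rather than an arbitrary
  complement, because it is stable under passing to homogeneous components.\<close>

lemma exists_monomial_complement:
  fixes Q :: "('x, 'k::field) mpoly set"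
  assumes Q: "is_ideal Q"
  obtains B where "\<And>p. Poly_Mapping.keys p \<subseteq> B \<Longrightarrow> p \<in> Q \<Longrightarrow> p = 0"
    "\<And>p. \<exists>q\<in>Q. Poly_Mapping.keys (p - q) \<subseteq> B"
proof -
  let ?A = "{B. \<forall>p\<in>Q. Poly_Mapping.keys p \<subseteq> B \<longrightarrow> p = 0}"
  have "\<exists>M\<in>?A. \<forall>X\<in>?A. M \<subseteq> X \<longrightarrow> X = M"
  proof (rule subset_Zorn')
    fix C assume C: "subset.chain ?A C"
    \<comment> \<open>A polynomial has finitely many monomials, so its support already lies in one
      member of the chain.\<close>
    show "\<Union>C \<in> ?A"
    proof (intro CollectI ballI impI)
      fix p assume p: "p \<in> Q" "Poly_Mapping.keys p \<subseteq> \<Union>C"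
      show "p = 0"
      proof (cases "C = {}")
        case True
        then show ?thesis using p by simp
      next
        case False
        then obtain X where "X \<in> C" "Poly_Mapping.keys p \<subseteq> X"
          using finite_subset_Union_chain[OF finite_keys p(2) False C] by blast
        moreover have "C \<subseteq> ?A" using C by (simp add: subset.chain_def)
        ultimately show ?thesis using p by blast
      qed
    qed
  qed
  then obtain B where B: "\<And>p. p \<in> Q \<Longrightarrow> Poly_Mapping.keys p \<subseteq> B \<Longrightarrow> p = 0"
    and max: "\<And>X. \<forall>p\<in>Q. Poly_Mapping.keys p \<subseteq> X \<longrightarrow> p = 0 \<Longrightarrow> B \<subseteq> X \<Longrightarrow> X = B"
    by auto
  have single: "\<exists>q\<in>Q. Poly_Mapping.keys (Poly_Mapping.single a 1 - q) \<subseteq> B" for a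
  proof (cases "a \<in> B")
    case True
    then show ?thesis by (intro bexI[of _ 0]) (simp_all add: ring_module.subspace_0[OF Q])
  next
    case False
    \<comment> \<open>By maximality, adding \<open>a\<close> creates a relation \<open>p\<close>.
      Its coefficient \<open>k\<close> at \<open>a\<close> is nonzero, as otherwise \<open>p\<close>
      would be supported on \<open>B\<close>; dividing by \<open>k\<close> rewrites the monomial
      \<open>a\<close> modulo \<open>Q\<close>.\<close>
    then obtain p where p: "p \<in> Q" "Poly_Mapping.keys p \<subseteq> insert a B" "p \<noteq> 0"
      using max[of "insert a B"] by auto
    define k where "k = Poly_Mapping.lookup p a"
    have "k \<noteq> 0" using B[OF p(1)] p(2,3) by (auto simp: k_def in_keys_iff)
    have "Poly_Mapping.single 0 (1 / k) * p \<in> Q" using ring_module.subspace_scale[OF Q] p(1) by blast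
    moreover have "Poly_Mapping.keys (Poly_Mapping.single a 1 - Poly_Mapping.single 0 (1 / k) * p) \<subseteq> B"
    proof
      fix b assume "b \<in> Poly_Mapping.keys (Poly_Mapping.single a 1 - Poly_Mapping.single 0 (1 / k) * p)"
      then have "b \<noteq> a" "b \<in> Poly_Mapping.keys p"
        using \<open>k \<noteq> 0\<close>
        by (auto simp: in_keys_iff lookup_minus lookup_single lookup_single_zero_mult when_def k_def split: if_splits)
      then show "b \<in> B" using p(2) by blast
    qed
    ultimately show ?thesis by blast
  qed
  have "\<exists>q\<in>Q. Poly_Mapping.keys (p - q) \<subseteq> B" for p
  proof -
    obtain q where q: "\<And>a. q a \<in> Q" "\<And>a. Poly_Mapping.keys (Poly_Mapping.single a 1 - q a) \<subseteq> B"
      using single by metis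
    define s where "s = (\<Sum>a\<in>Poly_Mapping.keys p. Poly_Mapping.single 0 (Poly_Mapping.lookup p a) * q a)"
    have "s \<in> Q"
      unfolding s_def using q(1) by (intro ring_module.subspace_sum[OF Q] ring_module.subspace_scale[OF Q])
    moreover have "Poly_Mapping.keys (p - s) \<subseteq> B"
    proof
      fix b assume b: "b \<in> Poly_Mapping.keys (p - s)"
      have "p - s = (\<Sum>a\<in>Poly_Mapping.keys p. Poly_Mapping.single 0 (Poly_Mapping.lookup p a) * (Poly_Mapping.single a 1 - q a))"
        unfolding s_def right_diff_distrib sum_subtractf
        by (subst (1) poly_mapping_sum_single) (simp add: mult_single)
      then have "Poly_Mapping.lookup (p - s) b =
        (\<Sum>a\<in>Poly_Mapping.keys p. Poly_Mapping.lookup p a * Poly_Mapping.lookup (Poly_Mapping.single a 1 - q a) b)"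
        by (simp only: lookup_sum lookup_single_zero_mult)
      then obtain a where "Poly_Mapping.lookup (Poly_Mapping.single a 1 - q a) b \<noteq> 0"
        using b by (metis (no_types, lifting) in_keys_iff mult_zero_right sum.neutral)
      then show "b \<in> B" using q(2)[of a] by (auto simp: in_keys_iff)
    qed
    ultimately show ?thesis by blast
  qed
  then show thesis using B that by blast
qed

text \<open>A form of degree 0 is a constant. If it is zero, regularity puts 1 into the ideal of the
  earlier members; if not, it is a unit. Either way the ideal of the sequence would not be
  proper.\<close>

lemma regular_sequence_homogeneous_degree_pos:
  fixes F :: "nat \<Rightarrow> ('x::finite, 'k::field) mpoly"
  assumes reg: "regular_sequence F t" and i: "i \<in> {1..t}" and hom: "homogeneous d (F i)"
  shows "d > 0"
proof (rule ccontr)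
  assume "\<not> d > 0"
  define k where "k = Poly_Mapping.lookup (F i) 0"
  have F: "F i = Poly_Mapping.single 0 k"
    using hom \<open>\<not> d > 0\<close>
    by (intro poly_mapping_eqI) (auto simp: k_def lookup_single when_def homogeneous_def mdeg_eq_0_iff in_keys_iff)
  have proper: "1 \<notin> ideal_gen (F ` {1..t})"
    using reg by (simp add: regular_sequence_def ideal_gen_eq_UNIV_iff)
  have "k \<noteq> 0"
  proof
    assume "k = 0"
    then have "F i * 1 \<in> ideal_gen (F ` {1..<i})" using F by (simp add: ideal_gen_zero)
    then have "1 \<in> ideal_gen (F ` {1..<i})" using reg i unfolding regular_sequence_def by blast
    moreover have "ideal_gen (F ` {1..<i}) \<subseteq> ideal_gen (F ` {1..t})"
      using i by (intro ideal_gen_mono image_mono) auto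
    ultimately show False using proper by blast
  qed
  then have "Poly_Mapping.single 0 (1 / k) * F i = 1" by (simp add: F mult_single)
  moreover have "Poly_Mapping.single 0 (1 / k) * F i \<in> ideal_gen (F ` {1..t})"
    using i by (intro ideal_gen_mult ideal_gen_base) auto
  ultimately show False using proper by simp
qed

text \<open>Induction on the degree: removing a part in \<open>W\<close> from a form leaves a
  combination of the \<open>F i\<close>, whose cofactors have smaller degree because every
  \<open>F i\<close> has positive degree.\<close>

lemma exists_expansion:
  fixes F :: "nat \<Rightarrow> ('x::finite, 'k::field) mpoly"
  assumes hom: "\<forall>i\<in>{1..t}. \<exists>d. homogeneous d (F i)" and reg: "regular_sequence F t"
  obtains W where "closed_diff W" "W \<inter> ideal_gen (F ` {1..t}) \<subseteq> {0}" "\<And>r. \<exists>w. expands F t W r w"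
proof -
  obtain B where B: "\<And>p. Poly_Mapping.keys p \<subseteq> B \<Longrightarrow> p \<in> ideal_gen (F ` {1..t}) \<Longrightarrow> p = 0"
    "\<And>p. \<exists>q\<in>ideal_gen (F ` {1..t}). Poly_Mapping.keys (p - q) \<subseteq> B"
    using exists_monomial_complement[OF is_ideal_ideal_gen] by metis
  define W :: "('x, 'k) mpoly set" where "W = {p. Poly_Mapping.keys p \<subseteq> B}"
  have W: "closed_diff W"
    unfolding closed_diff_def
  proof (intro conjI ballI)
    fix p q assume "p \<in> W" "q \<in> W"
    then show "p - q \<in> W" using keys_diff[of p q] unfolding W_def by blast
  qed (simp add: W_def)
  obtain d where d: "\<And>i. i \<in> {1..t} \<Longrightarrow> homogeneous (d i) (F i)" using hom by metis
  have exp_sum: "\<exists>w. expands F t W (\<Sum>i\<in>A. f i) w"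
    if "\<And>i. i \<in> A \<Longrightarrow> \<exists>w. expands F t W (f i) w" for A :: "nat set" and f
    using that
  proof (induction A rule: infinite_finite_induct)
    case (insert i A)
    then show ?case using expands_add[OF W] by (metis insertCI sum.insert)
  qed (use W in \<open>auto simp: expands_def expansion_sum_def closed_diff_def intro!: exI[of _ 0]\<close>)
  have "\<exists>w. expands F t W r w" if "homogeneous e r" for e r
    using that
  proof (induction e arbitrary: r rule: less_induct)
    case (less e)
    obtain q where q: "q \<in> ideal_gen (F ` {1..t})" "Poly_Mapping.keys (r - q) \<subseteq> B" using B(2) by blast
    obtain s where s: "q = (\<Sum>i\<in>{1..t}. F i * s i)" using q(1) by (auto simp: ideal_gen_finite)
    \<comment> \<open>Neither \<open>q\<close> nor the cofactors \<open>s i\<close> need be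
      homogeneous. Taking the part of degree \<open>e\<close> of the whole identity repairs this,
      and \<open>w0\<close> is still supported on \<open>B\<close>.\<close>
    define w0 where "w0 = homogeneous_part e (r - q)"
    have "r = (r - q) + (\<Sum>i\<in>{1..t}. F i * s i)" by (simp add: s)
    then have "homogeneous_part e r = w0 + (\<Sum>i\<in>{1..t}. homogeneous_part e (F i * s i))"
      unfolding w0_def homogeneous_part_sum[symmetric] homogeneous_part_add[symmetric] by simp
    then have r: "r = w0 + (\<Sum>i\<in>{1..t}. homogeneous_part e (F i * s i))"
      using homogeneous_part_homogeneous[OF less.prems, of e] by simp
    have w0: "expands F t W w0 (Poly_Mapping.single {#} w0)"
      using q(2) keys_homogeneous_part[of e "r - q"]
      by (auto simp: expands_def W_def w0_def expansion_sum_def lookup_single when_def)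
    have parts: "\<exists>w. expands F t W (homogeneous_part e (F i * s i)) w" if i: "i \<in> {1..t}" for i
    proof (cases "d i \<le> e")
      case True
      then have "e - d i < e" using regular_sequence_homogeneous_degree_pos[OF reg i d[OF i]] by simp
      then obtain w where "expands F t W (homogeneous_part (e - d i) (s i)) w"
        using less.IH homogeneous_homogeneous_part by blast
      then have "expands F t W (homogeneous_part (e - d i) (s i) * fmon F {#i#}) (shift {#i#} w)"
        using i by (intro expands_shift W) auto
      then show ?thesis using True by (auto simp: homogeneous_part_mult[OF d[OF i]] mult.commute)
    next
      case False
      then have "homogeneous_part e (F i * s i) = 0" by (simp add: homogeneous_part_mult[OF d[OF i]])
      moreover have "expands F t W 0 0"
        using W by (simp add: expands_def expansion_sum_def closed_diff_def)
      ultimately show ?thesis by auto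
    qed
    obtain w1 where "expands F t W (\<Sum>i\<in>{1..t}. homogeneous_part e (F i * s i)) w1"
      using exp_sum[of "{1..t}" "\<lambda>i. homogeneous_part e (F i * s i)"] parts by blast
    with w0 have "expands F t W (w0 + (\<Sum>i\<in>{1..t}. homogeneous_part e (F i * s i))) (Poly_Mapping.single {#} w0 + w1)"
      by (intro expands_add W)
    then show ?case using r by metis
  qed
  then have "\<exists>w. expands F t W r w" for r
    using exp_sum[of "mdeg ` Poly_Mapping.keys r" "\<lambda>e. homogeneous_part e r"] sum_homogeneous_part[of r]
    by (metis homogeneous_homogeneous_part)
  then show thesis using that[of W] W B(1) by (auto simp: W_def)
qed

section \<open>Ideals generated by products of the sequence\<close>

text \<open>To split \<open>x\<close>, a squarefree part with support \<open>D\<close> of size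
  \<open>d\<close> is removed. \<open>D\<close> must contain the set \<open>P\<close> of indices at
  the cap \<open>Suc m\<close> and lie in the support of \<open>x\<close>. It exists because
  \<open>Suc m * card P\<close> is at most the size \<open>Suc m * d\<close> of \<open>x\<close>,
  which in turn is at most \<open>Suc m\<close> times the size of the support.\<close>

lemma veronese_sum:
  "{a + b | a b. a \<in> veronese t d 1 \<and> b \<in> veronese t (m * d) m} = veronese t (Suc m * d) (Suc m)"
    (is "?L = ?R")
proof (intro equalityI subsetI)
  fix x assume "x \<in> ?L"
  then obtain a b where x: "x = a + b" and "a \<in> veronese t d 1" "b \<in> veronese t (m * d) m" by blast
  moreover from this have "count a i + count b i \<le> 1 + m" for i
    unfolding veronese_def by (intro add_mono) auto
  ultimately show "x \<in> ?R" by (auto simp: veronese_def)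
next
  fix x assume "x \<in> ?R"
  then have x: "set_mset x \<subseteq> {1..t}" "size x = Suc m * d" "\<And>i. count x i \<le> Suc m" by (auto simp: veronese_def)
  define P where "P = {i. count x i = Suc m}"
  have P: "P \<subseteq> set_mset x" by (auto simp: P_def simp flip: count_greater_zero_iff)
  then have "finite P" by (rule finite_subset) simp
  have "card P * Suc m = (\<Sum>i\<in>P. count x i)" by (simp add: P_def)
  also have "\<dots> \<le> (\<Sum>i\<in>set_mset x. count x i)" using P by (intro sum_mono2) auto
  also have "\<dots> = Suc m * d" using x(2) by (simp add: size_multiset_overloaded_eq)
  finally have "card P \<le> d" by (metis mult.commute mult_le_cancel1 zero_less_Suc)
  have "Suc m * d = (\<Sum>i\<in>set_mset x. count x i)" using x(2) by (simp add: size_multiset_overloaded_eq)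
  also have "\<dots> \<le> (\<Sum>i\<in>set_mset x. Suc m)" using x(3) by (intro sum_mono) auto
  finally have "d \<le> card (set_mset x)" by (simp only: sum_constant) (metis mult.commute mult_le_cancel1 of_nat_id zero_less_Suc)
  then obtain D where D: "P \<subseteq> D" "D \<subseteq> set_mset x" "card D = d"
    using exists_subset_between[OF \<open>card P \<le> d\<close> _ P] by auto
  have fD: "finite D" using D(2) by (rule finite_subset) simp
  define b where "b = x - mset_set D"
  have sub: "mset_set D \<subseteq># x"
  proof (rule mset_subset_eqI)
    fix i show "count (mset_set D) i \<le> count x i"
      using D(2) fD by (cases "i \<in> D") (auto simp: Suc_le_eq)
  qed
  then have xb: "x = mset_set D + b" by (simp add: b_def)
  have "mset_set D \<in> veronese t d 1"
    using D x(1) fD by (auto simp: veronese_def count_mset_set')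
  moreover have "b \<in> veronese t (m * d) m"
  proof -
    have "count b i \<le> m" for i
    proof (cases "i \<in> D")
      case True
      then show ?thesis using x(3)[of i] fD by (simp add: b_def)
    next
      case False
      then have "count x i \<noteq> Suc m" using D(1) by (auto simp: P_def)
      then show ?thesis using x(3)[of i] False by (simp add: b_def)
    qed
    moreover have "size b = m * d" using x(2) xb D(3) by (simp add: size_union)
    moreover have "set_mset b \<subseteq> {1..t}" using x(1) xb by auto
    ultimately show ?thesis by (auto simp: veronese_def)
  qed
  ultimately show "x \<in> ?L" using xb by blast
qed

lemma fmon_sum: "fmon F (\<Sum>i\<in>A. f i) = (\<Prod>i\<in>A. fmon F (f i))"
  by (induction A rule: infinite_finite_induct) simp_all

lemma power_products_eq: "power_products F t = fmon F ` {a. set_mset a \<subseteq> {1..t}}"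
proof (intro equalityI subsetI)
  fix x assume "x \<in> power_products F t"
  then obtain a where x: "x = (\<Prod>i\<in>{1..t}. F i ^ a i)" by (auto simp: power_products_def)
  have "x = fmon F (\<Sum>i\<in>{1..t}. replicate_mset (a i) i)"
    unfolding x fmon_sum by (intro prod.cong refl) (simp add: fmon_def)
  moreover have "set_mset (\<Sum>i\<in>{1..t}. replicate_mset (a i) i) \<subseteq> {1..t}"
    by (auto simp: set_mset_sum split: if_splits)
  ultimately show "x \<in> fmon F ` {a. set_mset a \<subseteq> {1..t}}" by blast
next
  fix x assume "x \<in> fmon F ` {a. set_mset a \<subseteq> {1..t}}"
  then obtain a where a: "set_mset a \<subseteq> {1..t}" "x = fmon F a" by blast
  have "x = (\<Prod>i\<in>set_mset a. F i ^ count a i)" using a(2) by (simp add: fmon_def image_prod_mset_multiplicity)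
  also have "\<dots> = (\<Prod>i\<in>{1..t}. F i ^ count a i)"
    using a(1) by (intro prod.mono_neutral_left) (auto simp: not_in_iff)
  finally show "x \<in> power_products F t" by (auto simp: power_products_def)
qed

text \<open>
  Here \<open>cf r\<close> lists the coefficients of \<open>r\<close> in its expansion in powers of the regular sequence,
  with coefficients taken from a fixed complement of the ideal generated by the sequence.
\<close>

locale monomial_expansion =
  fixes F :: "nat \<Rightarrow> 'a::comm_ring_1" and t :: nat and cf :: "'a \<Rightarrow> nat multiset \<Rightarrow>\<^sub>0 'a"
  assumes cf_add: "cf (r + s) = cf r + cf s"
    and set_cf: "c \<in> Poly_Mapping.keys (cf r) \<Longrightarrow> set_mset c \<subseteq> {1..t}"
    and expansion_sum_cf: "expansion_sum F (cf r) = r"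
    and cf_mult: "set_mset a \<subseteq> {1..t} \<Longrightarrow> cf (r * fmon F a) = shift a (cf r)"
    and proper: "ideal_gen (F ` {1..t}) \<noteq> UNIV"
begin

abbreviation coef :: "nat multiset \<Rightarrow> 'a \<Rightarrow> 'a" where
  "coef c r \<equiv> Poly_Mapping.lookup (cf r) c"

lemma coef_add: "coef c (r + s) = coef c r + coef c s"
  by (simp add: cf_add lookup_add)

lemma coef_zero [simp]: "coef c 0 = 0"
  using coef_add[of 0 0 c] by simp

lemma coef_sum: "coef c (\<Sum>x\<in>A. f x) = (\<Sum>x\<in>A. coef c (f x))"
  by (induction A rule: infinite_finite_induct) (simp_all add: coef_add)

lemma coef_fmon:
  "set_mset a \<subseteq> {1..t} \<Longrightarrow> coef c (r * fmon F a) = (if a \<subseteq># c then coef (c - a) r else 0)"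
  by (simp add: cf_mult lookup_shift)

lemma expand: "r = (\<Sum>c\<in>Poly_Mapping.keys (cf r). coef c r * fmon F c)"
  using expansion_sum_cf[of r] by (simp add: expansion_sum_def)

text \<open>Only \<open>r\<close> is split into terms; \<open>s\<close> multiplies each coefficient
  and the result is expanded again, so this is not a plain convolution.\<close>

lemma coef_mult_expand:
  "coef c' (s * r) =
     (\<Sum>c\<in>Poly_Mapping.keys (cf r). if c \<subseteq># c' then coef (c' - c) (s * coef c r) else 0)"
proof -
  have "s * r = (\<Sum>c\<in>Poly_Mapping.keys (cf r). s * coef c r * fmon F c)"
    by (subst expand[of r]) (simp add: sum_distrib_left mult.assoc)
  then have "coef c' (s * r) = (\<Sum>c\<in>Poly_Mapping.keys (cf r). coef c' (s * coef c r * fmon F c))"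
    by (simp add: coef_sum)
  also have "\<dots> = (\<Sum>c\<in>Poly_Mapping.keys (cf r). if c \<subseteq># c' then coef (c' - c) (s * coef c r) else 0)"
    by (intro sum.cong refl coef_fmon set_cf)
  finally show ?thesis .
qed

lemma coef_mult_nonzero:
  assumes "coef c' (s * r) \<noteq> 0" shows "\<exists>c. c \<subseteq># c' \<and> coef c r \<noteq> 0"
proof (rule ccontr)
  assume none: "\<not> ?thesis"
  have "\<not> c \<subseteq># c'" if "c \<in> Poly_Mapping.keys (cf r)" for c
    using none that unfolding in_keys_iff by blast
  then have "coef c' (s * r) = 0"
    by (subst coef_mult_expand) (intro sum.neutral, simp)
  then show False using assms by simp
qed

text \<open>Elements whose terms all lie above \<open>A\<close> form an ideal, since by
  \<open>coef_mult_nonzero\<close> every term of a multiple lies above an old term; conversely, each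
  such term is a multiple of a generator. Membership is thus tested term by term, and intersections
  become combinatorial.\<close>

lemma mem_monomial_ideal_iff:
  assumes A: "\<And>a. a \<in> A \<Longrightarrow> set_mset a \<subseteq> {1..t}"
  shows "r \<in> ideal_gen (fmon F ` A) \<longleftrightarrow> (\<forall>c. coef c r \<noteq> 0 \<longrightarrow> (\<exists>a\<in>A. a \<subseteq># c))"
proof
  let ?H = "{r. \<forall>c. coef c r \<noteq> 0 \<longrightarrow> (\<exists>a\<in>A. a \<subseteq># c)}"
  have "is_ideal ?H"
  proof (rule is_idealI)
    fix x y assume "x \<in> ?H" "y \<in> ?H"
    then show "x + y \<in> ?H" by (auto simp: coef_add) (metis add.right_neutral)
  next
    fix s x assume x: "x \<in> ?H"
    show "s * x \<in> ?H"
    proof (intro CollectI allI impI)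
      fix c assume "coef c (s * x) \<noteq> 0"
      then obtain c' where "c' \<subseteq># c" "coef c' x \<noteq> 0" using coef_mult_nonzero by blast
      then show "\<exists>a\<in>A. a \<subseteq># c" using x subset_mset.order_trans by blast
    qed
  qed simp
  moreover have "fmon F ` A \<subseteq> ?H"
    using coef_fmon[of _ 1] A by (auto split: if_splits)
  ultimately have "ideal_gen (fmon F ` A) \<subseteq> ?H" by (rule ideal_gen_minimal[rotated])
  then show "\<forall>c. coef c r \<noteq> 0 \<longrightarrow> (\<exists>a\<in>A. a \<subseteq># c)" if "r \<in> ideal_gen (fmon F ` A)" using that by blast
next
  assume *: "\<forall>c. coef c r \<noteq> 0 \<longrightarrow> (\<exists>a\<in>A. a \<subseteq># c)"
  have "coef c r * fmon F c \<in> ideal_gen (fmon F ` A)" if c: "c \<in> Poly_Mapping.keys (cf r)" for c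
  proof -
    obtain a where a: "a \<in> A" "a \<subseteq># c" using * c unfolding in_keys_iff by blast
    then have "c = (c - a) + a" by simp
    then have "fmon F c = fmon F (c - a) * fmon F a" by (metis fmon_simps(3))
    then show ?thesis
      using a(1) by (simp only:) (intro ideal_gen_mult ideal_gen_base imageI)
  qed
  then show "r \<in> ideal_gen (fmon F ` A)"
    by (subst expand[of r]) (rule ideal_gen_sum)
qed

text \<open>The locale does not say that the expansion of 1 is the single term 1. If its coefficient
  at \<open>{#}\<close> were 0, all its terms would be divisible by some \<open>F i\<close>, against
  properness.\<close>

lemma coef_one_nonzero: "coef {#} 1 \<noteq> 0"
proof
  assume "coef {#} 1 = 0"
  have "1 \<in> ideal_gen (fmon F ` (\<lambda>i. {#i#}) ` {1..t})"
  proof (subst mem_monomial_ideal_iff; (intro allI impI)?)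
    fix c assume c: "coef c 1 \<noteq> 0"
    then have "c \<noteq> {#}" using \<open>coef {#} 1 = 0\<close> by auto
    then obtain i where "i \<in># c" by blast
    moreover have "set_mset c \<subseteq> {1..t}" using c by (intro set_cf) (simp add: in_keys_iff)
    ultimately show "\<exists>a\<in>(\<lambda>i. {#i#}) ` {1..t}. a \<subseteq># c" by auto
  qed auto
  then show False using proper by (simp add: image_image ideal_gen_eq_UNIV_iff)
qed

lemma fmon_mem_monomial_ideal_iff:
  assumes "\<And>a. a \<in> A \<Longrightarrow> set_mset a \<subseteq> {1..t}" "set_mset b \<subseteq> {1..t}"
  shows "fmon F b \<in> ideal_gen (fmon F ` A) \<longleftrightarrow> (\<exists>a\<in>A. a \<subseteq># b)"
proof -
  have *: "coef c (fmon F b) = (if b \<subseteq># c then coef (c - b) 1 else 0)" for c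
    using coef_fmon[of b 1 c] assms(2) by simp
  show ?thesis
  proof (subst mem_monomial_ideal_iff[OF assms(1)])
    show "(\<forall>c. coef c (fmon F b) \<noteq> 0 \<longrightarrow> (\<exists>a\<in>A. a \<subseteq># c)) \<longleftrightarrow> (\<exists>a\<in>A. a \<subseteq># b)"
    proof
      assume "\<forall>c. coef c (fmon F b) \<noteq> 0 \<longrightarrow> (\<exists>a\<in>A. a \<subseteq># c)"
      moreover have "coef b (fmon F b) \<noteq> 0" using coef_one_nonzero by (simp add: *)
      ultimately show "\<exists>a\<in>A. a \<subseteq># b" by blast
    next
      assume "\<exists>a\<in>A. a \<subseteq># b"
      then show "\<forall>c. coef c (fmon F b) \<noteq> 0 \<longrightarrow> (\<exists>a\<in>A. a \<subseteq># c)"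
        unfolding * using subset_mset.order_trans by (auto split: if_splits)
    qed
  qed
qed

lemma fmon_inj:
  assumes "set_mset a \<subseteq> {1..t}" "set_mset b \<subseteq> {1..t}" "fmon F a = fmon F b"
  shows "a = b"
proof -
  have "b \<subseteq># a" "a \<subseteq># b"
    using fmon_mem_monomial_ideal_iff[of "{b}" a] fmon_mem_monomial_ideal_iff[of "{a}" b] assms
    by (auto simp: ideal_gen_base)
  then show ?thesis by (rule subset_mset.antisym[rotated])
qed

text \<open>All minimality arguments rest on exponents of equal size being pairwise incomparable.\<close>

lemma minimal_generating_set_fmon:
  assumes A: "\<And>a. a \<in> A \<Longrightarrow> set_mset a \<subseteq> {1..t}" "\<And>a. a \<in> A \<Longrightarrow> size a = e" and "finite A"
  shows "minimal_generating_set (ideal_gen (fmon F ` A)) (fmon F ` A)"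
  unfolding minimal_generating_set_def
proof (intro conjI allI impI notI)
  fix G assume G: "G \<subset> fmon F ` A" "ideal_gen G = ideal_gen (fmon F ` A)"
  define B where "B = {a \<in> A. fmon F a \<in> G}"
  have GB: "G = fmon F ` B" using G(1) by (auto simp: B_def)
  then obtain a where a: "a \<in> A" "a \<notin> B" using G(1) B_def by blast
  have "fmon F a \<in> ideal_gen (fmon F ` B)" using a G(2) GB by (simp add: ideal_gen_base)
  then obtain b where "b \<in> B" "b \<subseteq># a"
    using fmon_mem_monomial_ideal_iff[of B a] A(1) a(1) by (auto simp: B_def)
  moreover from this have "b = a" using A(2) a(1) by (intro size_eq_subseteq_mset) (auto simp: B_def)
  ultimately show False using a by simp
qed (use \<open>finite A\<close> in simp_all)

text \<open>An exponent \<open>a\<close> in \<open>A\<close> lies above some exponent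
  \<open>b\<close> of \<open>G\<close>, and \<open>b\<close> above some \<open>a'\<close> in
  \<open>A\<close>; equal sizes force all three to agree. So \<open>G\<close> contains every
  generator, and irredundancy excludes more. This determines the range of an arbitrary admissible
  \<open>g\<close> in the theorem.\<close>

lemma minimal_generating_set_unique:
  assumes A: "\<And>a. a \<in> A \<Longrightarrow> set_mset a \<subseteq> {1..t}" "\<And>a. a \<in> A \<Longrightarrow> size a = e"
    and G: "minimal_generating_set (ideal_gen (fmon F ` A)) G" "G \<subseteq> power_products F t"
  shows "G = fmon F ` A"
proof -
  define B where "B = {b. set_mset b \<subseteq> {1..t} \<and> fmon F b \<in> G}"
  have GB: "G = fmon F ` B" using G(2) by (auto simp: B_def power_products_eq)
  have eq: "ideal_gen (fmon F ` B) = ideal_gen (fmon F ` A)"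
    using G(1) GB by (simp add: minimal_generating_set_def)
  have "A \<subseteq> B"
  proof
    fix a assume a: "a \<in> A"
    have "fmon F a \<in> ideal_gen (fmon F ` B)" using a eq by (simp add: ideal_gen_base)
    then obtain b where b: "b \<in> B" "b \<subseteq># a"
      using fmon_mem_monomial_ideal_iff[of B a] A(1) a by (auto simp: B_def)
    have "fmon F b \<in> ideal_gen (fmon F ` A)" using b eq by (metis ideal_gen_base imageI)
    then obtain a' where a': "a' \<in> A" "a' \<subseteq># b"
      using fmon_mem_monomial_ideal_iff[of A b] A(1) b by (auto simp: B_def)
    have "a' = a"
      using a a' b A(2) subset_mset.order_trans by (intro size_eq_subseteq_mset) auto
    then have "b = a" using a' b by (simp add: subset_mset.antisym)
    then show "a \<in> B" using b by simp
  qed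
  then have "fmon F ` A \<subseteq> G" using GB by blast
  moreover have "\<not> fmon F ` A \<subset> G" using G(1) by (auto simp: minimal_generating_set_def)
  ultimately show ?thesis by blast
qed

section \<open>Star configurations and their powers\<close>

text \<open>The ideal of a subset \<open>A\<close> consists of the elements whose terms all have
  support meeting \<open>A\<close>. A support meets every subset with \<open>h\<close> elements iff
  its complement has fewer than \<open>h\<close>, that is, iff it has at least
  \<open>t - h + 1\<close> elements.\<close>

lemma star_configuration_eq:
  assumes h: "h \<le> t"
  shows "star_configuration h F t = ideal_gen (fmon F ` veronese t (t - h + 1) 1)"
proof -
  have gen: "F ` A = fmon F ` (\<lambda>i. {#i#}) ` A" for A by (simp add: image_image)
  have mem: "r \<in> ideal_gen (F ` A) \<longleftrightarrow> (\<forall>c. coef c r \<noteq> 0 \<longrightarrow> A \<inter> set_mset c \<noteq> {})"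
    if "A \<subseteq> {1..t}" for A r
    unfolding gen by (subst mem_monomial_ideal_iff) (use that in auto)
  have V: "set_mset a \<subseteq> {1..t}" if "a \<in> veronese t (t - h + 1) 1" for a
    using that by (simp add: veronese_def)
  have mem_V: "r \<in> ideal_gen (fmon F ` veronese t (t - h + 1) 1) \<longleftrightarrow>
    (\<forall>c. coef c r \<noteq> 0 \<longrightarrow> (\<exists>a\<in>veronese t (t - h + 1) 1. a \<subseteq># c))" for r
    by (rule mem_monomial_ideal_iff) (rule V)
  show ?thesis
  proof (intro equalityI subsetI)
    fix r assume r: "r \<in> star_configuration h F t"
    show "r \<in> ideal_gen (fmon F ` veronese t (t - h + 1) 1)"
      unfolding mem_V
    proof (intro allI impI)
      fix c assume c: "coef c r \<noteq> 0"
      have sc: "set_mset c \<subseteq> {1..t}" using c by (intro set_cf) (simp add: in_keys_iff)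
      have "t - h + 1 \<le> card (set_mset c)"
      proof (rule ccontr)
        assume "\<not> ?thesis"
        moreover have "card ({1..t} - set_mset c) = t - card (set_mset c)"
          using sc by (simp add: card_Diff_subset)
        ultimately have "h \<le> card ({1..t} - set_mset c)" using h by linarith
        then obtain A where A: "A \<subseteq> {1..t} - set_mset c" "card A = h"
          by (rule obtain_subset_with_card_n)
        then have "r \<in> ideal_gen (F ` A)" using r by (auto simp: star_configuration_def)
        moreover have "A \<subseteq> {1..t}" using A by blast
        ultimately show False using mem c A(1) by blast
      qed
      then obtain D where D: "D \<subseteq> set_mset c" "card D = t - h + 1" "finite D"
        by (rule obtain_subset_with_card_n)
      have "mset_set D \<in> veronese t (t - h + 1) 1"
        using D sc by (auto simp: veronese_def count_mset_set')
      moreover have "mset_set D \<subseteq># c"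
      proof (rule mset_subset_eqI)
        fix i show "count (mset_set D) i \<le> count c i"
          using D by (cases "i \<in> D") (auto simp: Suc_le_eq)
      qed
      ultimately show "\<exists>a\<in>veronese t (t - h + 1) 1. a \<subseteq># c" by blast
    qed
  next
    fix r assume r: "r \<in> ideal_gen (fmon F ` veronese t (t - h + 1) 1)"
    show "r \<in> star_configuration h F t"
      unfolding star_configuration_def
    proof (intro INT_I, elim CollectE conjE)
      fix A assume A: "A \<subseteq> {1..t}" "card A = h"
      show "r \<in> ideal_gen (F ` A)"
        unfolding mem[OF A(1)]
      proof (intro allI impI notI)
        fix c assume c: "coef c r \<noteq> 0" and disj: "A \<inter> set_mset c = {}"
        then obtain a where a: "a \<in> veronese t (t - h + 1) 1" "a \<subseteq># c"
          using r mem_V by blast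
        have "size a = (\<Sum>i\<in>set_mset a. count a i)" by (simp add: size_multiset_overloaded_eq)
        also have "\<dots> \<le> (\<Sum>i\<in>set_mset a. 1)" using a(1) by (intro sum_mono) (simp add: veronese_def)
        finally have "t - h + 1 \<le> card (set_mset a)" using a(1) by (simp add: veronese_def)
        moreover have "set_mset a \<subseteq> {1..t} - A"
          using V[OF a(1)] disj set_mset_mono[OF a(2)] by blast
        then have "card (set_mset a) \<le> card ({1..t} - A)" by (intro card_mono) auto
        moreover have "card ({1..t} - A) = t - h"
          using A finite_subset[OF A(1)] by (simp add: card_Diff_subset)
        ultimately show False by simp
      qed
    qed
  qed
qed

lemma ideal_power_veronese:
  "ideal_power (ideal_gen (fmon F ` veronese t d 1)) m = ideal_gen (fmon F ` veronese t (m * d) m)"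
proof (induction m)
  case 0
  \<comment> \<open>For \<open>m = 0\<close> size and cap both vanish; only the exponent of 1
    remains, which gives the unit ideal.\<close>
  have "veronese t 0 0 = {{#}}" by (auto simp: veronese_def)
  then show ?case using ideal_gen_eq_UNIV_iff[of "{1 :: 'a}"] by (simp add: ideal_gen_base)
next
  case (Suc m)
  have "{a * b | a b. a \<in> fmon F ` veronese t d 1 \<and> b \<in> fmon F ` veronese t (m * d) m} =
    fmon F ` {a + b | a b. a \<in> veronese t d 1 \<and> b \<in> veronese t (m * d) m}"
    by (force simp: image_iff)
  also have "\<dots> = fmon F ` veronese t (Suc m * d) (Suc m)" by (simp only: veronese_sum)
  finally show ?case unfolding ideal_power.simps Suc.IH ideal_gen_products by (rule arg_cong)
qed

end

text \<open>Expansions are chosen arbitrarily; uniqueness then forces the choice to be additive and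
  to turn multiplication by \<open>fmon F a\<close> into a shift.\<close>

lemma regular_sequence_monomial_expansion:
  fixes F :: "nat \<Rightarrow> ('x::finite, 'k::field) mpoly"
  assumes hom: "\<forall>i\<in>{1..t}. \<exists>d. homogeneous d (F i)" and reg: "regular_sequence F t"
  obtains cf where "monomial_expansion F t cf"
proof -
  obtain W where W: "closed_diff W" "W \<inter> ideal_gen (F ` {1..t}) \<subseteq> {0}" "\<And>r. \<exists>w. expands F t W r w"
    using exists_expansion[OF hom reg] by metis
  obtain cf where cf: "\<And>r. expands F t W r (cf r)" using W(3) by metis
  note unique = expands_unique[OF reg W(2,1)]
  have "monomial_expansion F t cf"
  proof
    show "cf (r + s) = cf r + cf s" for r s
      using unique expands_add[OF W(1)] cf by blast
    show "cf (r * fmon F a) = shift a (cf r)" if "set_mset a \<subseteq> {1..t}" for a r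
      using unique expands_shift[OF W(1)] cf that by blast
    show "set_mset c \<subseteq> {1..t}" if "c \<in> Poly_Mapping.keys (cf r)" for c r
      using cf that unfolding expands_def by blast
    show "expansion_sum F (cf r) = r" for r
      using cf unfolding expands_def by metis
    show "ideal_gen (F ` {1..t}) \<noteq> UNIV"
      using reg by (simp add: regular_sequence_def)
  qed
  then show thesis by (rule that)
qed

section \<open>Evaluation and the Rees algebra\<close>

lemma mp_eval_single:
  "h 0 = 0 \<Longrightarrow> mp_eval h v (Poly_Mapping.single a r) = h r * (\<Prod>i\<in>UNIV. v i ^ Poly_Mapping.lookup a i)"
  by (simp add: mp_eval_def)

locale coefficient_hom =
  fixes h :: "'a::comm_ring_1 \<Rightarrow> 'b::comm_ring_1" and v :: "'x::finite \<Rightarrow> 'b"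
  assumes h_zero: "h 0 = 0" and h_one: "h 1 = 1"
    and h_add: "h (r + s) = h r + h s" and h_mult: "h (r * s) = h r * h s"
begin

lemma mp_eval_add: "mp_eval h v (p + q) = mp_eval h v p + mp_eval h v q"
  unfolding mp_eval_def
  by (rule setsum_keys_plus_distrib) (simp_all add: h_zero h_add distrib_right)

lemma mp_eval_zero: "mp_eval h v 0 = 0"
  by (simp add: mp_eval_def)

lemma mp_eval_diff: "mp_eval h v (p - q) = mp_eval h v p - mp_eval h v q"
  using mp_eval_add[of "p - q" q] by simp

lemma mp_eval_sum: "mp_eval h v (\<Sum>x\<in>A. f x) = (\<Sum>x\<in>A. mp_eval h v (f x))"
  by (induction A rule: infinite_finite_induct) (simp_all add: mp_eval_zero mp_eval_add)

lemma mp_eval_mult: "mp_eval h v (p * q) = mp_eval h v p * mp_eval h v q"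
proof -
  have single: "mp_eval h v (Poly_Mapping.single a r * Poly_Mapping.single b s) =
      mp_eval h v (Poly_Mapping.single a r) * mp_eval h v (Poly_Mapping.single b s)" for a b r s
    by (simp add: mult_single mp_eval_single h_zero h_mult lookup_add power_add prod.distrib ac_simps)
  define P where "P a = Poly_Mapping.single a (Poly_Mapping.lookup p a)" for a
  define Q where "Q a = Poly_Mapping.single a (Poly_Mapping.lookup q a)" for a
  have p: "p = (\<Sum>a\<in>Poly_Mapping.keys p. P a)" and q: "q = (\<Sum>a\<in>Poly_Mapping.keys q. Q a)"
    unfolding P_def Q_def by (rule poly_mapping_sum_single)+
  have "mp_eval h v ((\<Sum>a\<in>A. P a) * (\<Sum>b\<in>B. Q b)) = mp_eval h v (\<Sum>a\<in>A. P a) * mp_eval h v (\<Sum>b\<in>B. Q b)" for A B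
    by (simp add: sum_product mp_eval_sum) (simp add: P_def Q_def single)
  then show ?thesis using p q by metis
qed

lemma mp_eval_const: "mp_eval h v (Poly_Mapping.single 0 r) = h r"
  by (simp add: mp_eval_single h_zero)

lemma mp_eval_var: "mp_eval h v (mp_var i) = v i"
proof -
  have "(\<Prod>j\<in>UNIV. v j ^ Poly_Mapping.lookup (Poly_Mapping.single i 1) j) = (\<Prod>j\<in>UNIV. if j = i then v j else 1)"
    by (intro prod.cong) (auto simp: lookup_single when_def)
  then show ?thesis by (simp add: mp_var_def mp_eval_single h_zero h_one)
qed

end

interpretation rees: coefficient_hom "\<lambda>r. [:r:]" "\<lambda>i. monom (g i) (Suc 0)" for g :: "'x::finite \<Rightarrow> 'a::comm_ring_1"
  by unfold_locales (simp_all add: one_pCons)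

text \<open>This is \<open>rees_map\<close> composed with \<open>extend_coeffs\<close>, as
  \<open>rees_map_ext\<close> shows. Viewed as a single evaluation map over the field, it is a ring
  map without a separate study of \<open>extend_coeffs\<close>.\<close>

interpretation rees_ext: coefficient_hom "\<lambda>k. [:mp_const k:]" "\<lambda>i. monom (g i) (Suc 0)"
  for g :: "'x::finite \<Rightarrow> ('n, 'k::field) mpoly"
  by unfold_locales (simp_all add: one_pCons mp_const_def single_add mult_single mult.commute)

section \<open>Monomials in the T-variables as multisets\<close>

definition exponent_mset :: "('x::finite \<Rightarrow>\<^sub>0 nat) \<Rightarrow> 'x multiset" where
  "exponent_mset a = (\<Sum>i\<in>UNIV. replicate_mset (Poly_Mapping.lookup a i) i)"

lemma prod_mset_sum_replicate:
  "(\<Prod>i\<in>#(\<Sum>i\<in>A. replicate_mset (f i) i). v i) = (\<Prod>i\<in>A. v i ^ f i :: 'b::comm_monoid_mult)"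
  by (induction A rule: infinite_finite_induct) simp_all

lemma prod_mset_exponent_mset:
  "(\<Prod>i\<in>#exponent_mset a. v i) = (\<Prod>i\<in>UNIV. v i ^ Poly_Mapping.lookup a i :: 'b::comm_monoid_mult)"
  by (simp add: exponent_mset_def prod_mset_sum_replicate)

lemma size_exponent_mset: "size (exponent_mset a) = mdeg a"
proof -
  have "size (\<Sum>i\<in>A. replicate_mset (Poly_Mapping.lookup a i) i) = (\<Sum>i\<in>A. Poly_Mapping.lookup a i)" for A
    by (induction A rule: infinite_finite_induct) simp_all
  then show ?thesis by (simp add: exponent_mset_def mdeg_def)
qed

definition tmon :: "'x multiset \<Rightarrow> ('x, 'a::comm_ring_1) mpoly" where
  "tmon \<alpha> = (\<Prod>i\<in>#\<alpha>. mp_var i)"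

lemma tmon_simps [simp]:
  "tmon {#} = 1" "tmon (add_mset i \<alpha>) = mp_var i * tmon \<alpha>" "tmon (\<alpha> + \<beta>) = tmon \<alpha> * tmon \<beta>"
  by (simp_all add: tmon_def)

lemma single_eq_tmon: "Poly_Mapping.single a (r :: 'a::comm_ring_1) = Poly_Mapping.single 0 r * tmon (exponent_mset a)"
proof -
  have pow: "mp_var i ^ n = Poly_Mapping.single (Poly_Mapping.single i n) (1 :: 'a)" for i and n
    by (induction n) (simp_all add: mp_var_def mult_single flip: single_add)
  have prod: "(\<Prod>i\<in>A. Poly_Mapping.single (f i) (1 :: 'a)) = Poly_Mapping.single (\<Sum>i\<in>A. f i) 1" for A f
    by (induction A rule: infinite_finite_induct) (simp_all add: mult_single)
  have "(\<Sum>i\<in>UNIV. Poly_Mapping.single i (Poly_Mapping.lookup a i)) = a"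
    by (rule poly_mapping_eqI) (simp add: lookup_sum lookup_single when_def)
  then have "tmon (exponent_mset a) = Poly_Mapping.single a (1 :: 'a)"
    by (simp add: tmon_def prod_mset_exponent_mset pow prod)
  then show ?thesis by (simp add: mult_single)
qed

lemma mpoly_sum_tmon:
  "p = (\<Sum>a\<in>Poly_Mapping.keys p. Poly_Mapping.single 0 (Poly_Mapping.lookup p a) * tmon (exponent_mset a))"
  using poly_mapping_sum_single[of p] by (simp flip: single_eq_tmon)

lemma mp_const_eq_0_iff: "mp_const a = 0 \<longleftrightarrow> a = 0"
  unfolding mp_const_def by (metis lookup_single_eq lookup_zero single_zero)

lemma lookup_extend_coeffs:
  "Poly_Mapping.lookup (extend_coeffs p) a = mp_const (Poly_Mapping.lookup p a)"
  by (simp add: extend_coeffs_def Poly_Mapping.map.rep_eq when_def) (simp add: mp_const_def)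

lemma rees_map_ext:
  fixes g :: "'x::finite \<Rightarrow> ('n, 'k::field) mpoly"
  shows "rees_map g (extend_coeffs p) = mp_eval (\<lambda>k. [:mp_const k:]) (\<lambda>i. monom (g i) 1) p"
proof -
  have "Poly_Mapping.keys (extend_coeffs p :: ('x, ('n, 'k) mpoly) mpoly) = Poly_Mapping.keys p"
    by (intro equalityI subsetI) (simp_all add: in_keys_iff lookup_extend_coeffs mp_const_eq_0_iff)
  then show ?thesis by (simp add: rees_map_def mp_eval_def lookup_extend_coeffs)
qed

lemma prod_mset_monom: "(\<Prod>i\<in>#\<alpha>. monom (g i) (Suc 0)) = monom (\<Prod>i\<in>#\<alpha>. g i :: 'a::comm_ring_1) (size \<alpha>)"
  by (induction \<alpha>) (simp_all add: mult_monom)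

text \<open>Each variable contributes one factor \<open>\<tau>\<close>, so the coefficient at
  \<open>k\<close> sees exactly the monomials of degree \<open>k\<close> in the
  \<open>T\<close>-variables.\<close>

lemma coeff_mp_eval_monom:
  fixes h :: "'a::zero \<Rightarrow> 'b::comm_ring_1"
  shows "coeff (mp_eval (\<lambda>r. [:h r:]) (\<lambda>i. monom (g i) 1) p) k =
     (\<Sum>a\<in>{a\<in>Poly_Mapping.keys p. mdeg a = k}. h (Poly_Mapping.lookup p a) * (\<Prod>i\<in>#exponent_mset a. g i))"
proof -
  have "coeff ([:r:] * (\<Prod>i\<in>UNIV. monom (g i) 1 ^ Poly_Mapping.lookup a i)) k =
      (if mdeg a = k then r * (\<Prod>i\<in>#exponent_mset a. g i) else 0)" for a and r :: 'b
    by (simp add: prod_mset_monom size_exponent_mset flip: prod_mset_exponent_mset)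
  then have "coeff (mp_eval (\<lambda>r. [:h r:]) (\<lambda>i. monom (g i) 1) p) k =
     (\<Sum>a\<in>Poly_Mapping.keys p. if mdeg a = k then h (Poly_Mapping.lookup p a) * (\<Prod>i\<in>#exponent_mset a. g i) else 0)"
    by (simp add: mp_eval_def coeff_sum)
  then show ?thesis by (simp add: sum.inter_filter)
qed

lemma rees_map_tmon: "rees_map g (Poly_Mapping.single 0 r * tmon \<alpha>) = monom (r * (\<Prod>i\<in>#\<alpha>. g i)) (size \<alpha>)"
proof -
  have "rees_map g (tmon \<alpha>) = (\<Prod>i\<in>#\<alpha>. monom (g i) (Suc 0))"
    by (induction \<alpha>) (simp_all add: rees_map_def rees.mp_eval_mult rees.mp_eval_var rees.mp_eval_const flip: single_one)
  then show ?thesis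
    by (simp add: rees_map_def rees.mp_eval_mult rees.mp_eval_const prod_mset_monom smult_monom)
qed

lemma is_ideal_rees_defining_ideal: "is_ideal (rees_defining_ideal g)"
  by (rule is_idealI) (simp_all add: rees_defining_ideal_def rees_map_def rees.mp_eval_zero rees.mp_eval_add rees.mp_eval_mult)

section \<open>Ring structure of the Rees algebra\<close>

lemma ring_rees_ring: "ring (rees_ring J)"
proof -
  have zero: "(0 :: 'a poly) \<in> carrier (rees_ring J)"
    by (simp add: rees_ring_def ring_module.subspace_0[OF is_ideal_ideal_power])
  have one: "(1 :: 'a poly) \<in> carrier (rees_ring J)"
    by (auto simp: rees_ring_def coeff_1 ring_module.subspace_0[OF is_ideal_ideal_power])
  have add: "p + q \<in> carrier (rees_ring J)" if "p \<in> carrier (rees_ring J)" "q \<in> carrier (rees_ring J)" for p q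
    using that by (simp add: rees_ring_def ring_module.subspace_add[OF is_ideal_ideal_power])
  have uminus: "- p \<in> carrier (rees_ring J)" if "p \<in> carrier (rees_ring J)" for p
    using that by (simp add: rees_ring_def ring_module.subspace_neg[OF is_ideal_ideal_power])
  have mult: "p * q \<in> carrier (rees_ring J)" if "p \<in> carrier (rees_ring J)" "q \<in> carrier (rees_ring J)" for p q
  proof -
    have "coeff p i * coeff q (n - i) \<in> ideal_power J n" if "i \<le> n" for i n
      using ideal_power_mult_mem[of "coeff p i" J i "coeff q (n - i)" "n - i"] \<open>p \<in> _\<close> \<open>q \<in> _\<close> that
      by (simp add: rees_ring_def)
    then show ?thesis
      by (simp add: rees_ring_def coeff_mult) (intro allI ring_module.subspace_sum[OF is_ideal_ideal_power], simp)
  qed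
  have ops: "x \<oplus>\<^bsub>rees_ring J\<^esub> y = x + y" "x \<otimes>\<^bsub>rees_ring J\<^esub> y = x * y" "\<zero>\<^bsub>rees_ring J\<^esub> = 0" "\<one>\<^bsub>rees_ring J\<^esub> = 1" for x y
    by (simp_all add: rees_ring_def)
  show ?thesis
  proof (rule ringI)
    show "abelian_group (rees_ring J)"
      by (rule abelian_groupI) (auto simp: ops add zero ac_simps intro: uminus bexI[of _ "- x" for x])
    show "Group.monoid (rees_ring J)"
      by unfold_locales (simp_all add: ops mult one mult.assoc)
  qed (simp_all add: ops distrib_left distrib_right)
qed

section \<open>Order filtration and the irrelevant ideal\<close>

text \<open>The ideal generated by the variables, described as the kernel of evaluation at the
  origin.\<close>

definition zero_const :: "('n, 'k::comm_ring_1) mpoly set" where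
  "zero_const = {p. Poly_Mapping.lookup p 0 = 0}"

lemma is_ideal_zero_const: "is_ideal (zero_const :: ('n, 'k::comm_ring_1) mpoly set)"
proof (rule is_idealI)
  fix r x :: "('n, 'k) mpoly" assume x: "x \<in> zero_const"
  have "0 \<notin> Poly_Mapping.keys (r * x)"
  proof
    assume "0 \<in> Poly_Mapping.keys (r * x)"
    then obtain a b where ab: "0 = a + b" "b \<in> Poly_Mapping.keys x" using keys_mult[of r x] by blast
    have "Poly_Mapping.lookup b i = 0" for i using ab(1) by (metis lookup_add lookup_zero add_is_0)
    then have "b = 0" by (intro poly_mapping_eqI) simp
    then show False using ab(2) x by (simp add: zero_const_def in_keys_iff)
  qed
  then show "r * x \<in> zero_const" by (simp add: zero_const_def in_keys_iff)
qed (simp_all add: zero_const_def lookup_add)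

text \<open>The coefficient ring is left open because the same binomials are used over the field and
  over \<open>R\<close>.\<close>

definition quadrics :: "('m \<Rightarrow> nat multiset) \<Rightarrow> ('m, 'k::comm_ring_1) mpoly set" where
  "quadrics u = {mp_var x * mp_var y - mp_var z * mp_var w | x y z w. u x + u y = u z + u w}"

lemma total_degree_quadrics:
  fixes p :: "('m::finite, 'k::comm_ring_1) mpoly"
  assumes "p \<in> quadrics u" shows "total_degree p \<le> 2"
proof -
  obtain x y z w where p: "p = mp_var x * mp_var y - mp_var z * mp_var w" using assms by (auto simp: quadrics_def)
  have mdeg_single: "mdeg (Poly_Mapping.single i (Suc 0)) = 1" for i :: 'm
    by (simp add: mdeg_def lookup_single when_def)
  have "Poly_Mapping.keys p \<subseteq> Poly_Mapping.keys (mp_var x * mp_var y :: ('m, 'k) mpoly) \<union> Poly_Mapping.keys (mp_var z * mp_var w :: ('m, 'k) mpoly)"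
    unfolding p by (rule keys_diff)
  also have "\<dots> \<subseteq> {a. mdeg a = 2}"
    by (simp add: mp_var_def mult_single mdeg_single)
  finally show ?thesis by (auto simp: total_degree_def)
qed

text \<open>\<open>lookup_F\<close> places the sequence in the irrelevant ideal; this links
  expansions in powers of \<open>F\<close> to residues in the field.\<close>

locale star_rees = monomial_expansion F t cf + veronese_bijection u t e m
  for F :: "nat \<Rightarrow> ('n::finite, 'k::field) mpoly" and t cf and u :: "'m::finite \<Rightarrow> nat multiset" and e m +
  assumes lookup_F: "i \<in> {1..t} \<Longrightarrow> Poly_Mapping.lookup (F i) 0 = 0"
begin

abbreviation g :: "'m \<Rightarrow> ('n, 'k) mpoly" where
  "g x \<equiv> fmon F (u x)"

definition J :: "('n, 'k) mpoly set" where
  "J = ideal_gen (fmon F ` veronese t e m)"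

lemma prod_g: "(\<Prod>x\<in>#\<alpha>. g x) = fmon F (weight \<alpha>)"
  by (induction \<alpha>) simp_all

lemma fmon_zero_const: "set_mset c \<subseteq> {1..t} \<Longrightarrow> c \<noteq> {#} \<Longrightarrow> fmon F c \<in> zero_const"
proof -
  assume c: "set_mset c \<subseteq> {1..t}" "c \<noteq> {#}"
  then obtain i c' where "c = add_mset i c'" by (metis multiset_cases)
  moreover from this have "F i \<in> zero_const" using c lookup_F by (simp add: zero_const_def)
  ultimately show ?thesis
    using ring_module.subspace_scale[OF is_ideal_zero_const, of "F i" "fmon F c'"] by (simp add: mult.commute)
qed

text \<open>All terms other than the one at \<open>{#}\<close> are multiples of some
  \<open>F i\<close> and vanish modulo the variables. So \<open>coef {#}\<close> preserves residues
  in the field, although its values need not be constant polynomials.\<close>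

lemma diff_coef_zero_const: "r - coef {#} r \<in> zero_const"
proof -
  define K where "K = Poly_Mapping.keys (cf r)"
  have "r = (\<Sum>c\<in>K. coef c r * fmon F c)" unfolding K_def by (rule expand)
  also have "\<dots> = (\<Sum>c\<in>insert {#} K. coef c r * fmon F c)"
    by (rule sum.mono_neutral_left) (auto simp: K_def in_keys_iff)
  also have "\<dots> = coef {#} r + (\<Sum>c\<in>K - {{#}}. coef c r * fmon F c)"
    by (subst sum.insert_remove) (simp_all add: K_def)
  finally have eq: "r = coef {#} r + (\<Sum>c\<in>K - {{#}}. coef c r * fmon F c)" .
  have "r - coef {#} r = (\<Sum>c\<in>K - {{#}}. coef c r * fmon F c)"
    unfolding diff_eq_eq add.commute[of _ "coef {#} r"] by (rule eq)
  also have "\<dots> \<in> zero_const"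
    using set_cf
    by (intro ring_module.subspace_sum[OF is_ideal_zero_const] ring_module.subspace_scale[OF is_ideal_zero_const] fmon_zero_const)
      (auto simp: K_def)
  finally show ?thesis .
qed

lemma coef_empty_zero_const_iff: "coef {#} r \<in> zero_const \<longleftrightarrow> r \<in> zero_const"
  using diff_coef_zero_const[of r] by (simp add: zero_const_def lookup_minus)

lemma coef_const_zero_constD: "coef {#} (mp_const k) \<in> zero_const \<Longrightarrow> k = 0"
  unfolding coef_empty_zero_const_iff by (simp add: zero_const_def mp_const_def)

text \<open>The \<open>N\<close>-th power of the ideal \<open>(F)\<close>, read off from
  expansions.\<close>

definition order_ge :: "nat \<Rightarrow> ('n, 'k) mpoly set" where
  "order_ge N = {r. \<forall>c. size c < N \<longrightarrow> coef c r = 0}"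

lemma is_ideal_order_ge: "is_ideal (order_ge N)"
proof (rule is_idealI)
  fix s r assume r: "r \<in> order_ge N"
  show "s * r \<in> order_ge N"
    unfolding order_ge_def
  proof (intro CollectI allI impI, rule ccontr)
    fix c assume "size c < N" "coef c (s * r) \<noteq> 0"
    then obtain c' where "c' \<subseteq># c" "coef c' r \<noteq> 0" using coef_mult_nonzero by blast
    moreover have "size c' < N" using size_mset_mono[OF \<open>c' \<subseteq># c\<close>] \<open>size c < N\<close> by linarith
    ultimately show False using r by (auto simp: order_ge_def)
  qed
qed (simp_all add: order_ge_def coef_add)

lemma order_ge_mult:
  assumes s: "s \<in> order_ge M" and r: "r \<in> order_ge N" shows "s * r \<in> order_ge (M + N)"
  unfolding order_ge_def
proof (intro CollectI allI impI)
  fix c :: "nat multiset" assume c: "size c < M + N"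
  show "coef c (s * r) = 0"
  proof (subst coef_mult_expand, rule sum.neutral, rule ballI)
    fix c' assume "c' \<in> Poly_Mapping.keys (cf r)"
    then have "N \<le> size c'" using r unfolding order_ge_def in_keys_iff by (auto simp: not_less[symmetric])
    moreover have "coef c' r * s \<in> order_ge M" by (rule ring_module.subspace_scale[OF is_ideal_order_ge s])
    moreover have "size (c - c') < M" if "c' \<subseteq># c" "N \<le> size c'"
      using that c size_mset_mono[OF that(1)] by (simp add: size_Diff_submset)
    ultimately show "(if c' \<subseteq># c then coef (c - c') (s * coef c' r) else 0) = 0"
      by (simp add: order_ge_def mult.commute)
  qed
qed

lemma ideal_power_J_order_ge: "ideal_power J i \<subseteq> order_ge (i * e)"
proof -
  have J: "J \<subseteq> order_ge e"
    unfolding J_def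
  proof (rule ideal_gen_minimal[OF _ is_ideal_order_ge], rule image_subsetI)
    fix a assume a: "a \<in> veronese t e m"
    then have "coef c (fmon F a) = (if a \<subseteq># c then coef (c - a) 1 else 0)" for c
      using coef_fmon[of a 1 c] by (simp add: veronese_def)
    moreover have "\<not> a \<subseteq># c" if "size c < e" for c
      using size_mset_mono[of a c] that a by (auto simp: veronese_def)
    ultimately show "fmon F a \<in> order_ge e" by (simp add: order_ge_def)
  qed
  show ?thesis
  proof (induction i)
    case 0
    then show ?case by (simp add: order_ge_def)
  next
    case (Suc i)
    then show ?case
      unfolding ideal_power.simps using J order_ge_mult[of _ e _ "i * e"]
      by (intro ideal_gen_minimal is_ideal_order_ge) auto
  qed
qed

text \<open>The product of the irrelevant ideal with the \<open>N\<close>-th power of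
  \<open>(F)\<close>: terms of order above \<open>N\<close> belong to it automatically, those of
  order \<open>N\<close> if their coefficients vanish modulo the variables.\<close>

definition order_ge_zero :: "nat \<Rightarrow> ('n, 'k) mpoly set" where
  "order_ge_zero N = {r \<in> order_ge N. \<forall>c. size c = N \<longrightarrow> coef c r \<in> zero_const}"

text \<open>For size reasons only the term of \<open>r\<close> at \<open>c\<close> itself
  contributes, namely the coefficient at \<open>{#}\<close> of a multiple of
  \<open>x\<close>.\<close>

lemma zero_const_mult_order_ge:
  assumes x: "x \<in> zero_const" and r: "r \<in> order_ge N" and c: "size c = N"
  shows "coef c (x * r) \<in> zero_const"
proof (subst coef_mult_expand, rule ring_module.subspace_sum[OF is_ideal_zero_const])
  fix c' assume c': "c' \<in> Poly_Mapping.keys (cf r)"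
  then have N: "N \<le> size c'" using r unfolding order_ge_def in_keys_iff by (auto simp: not_less[symmetric])
  show "(if c' \<subseteq># c then coef (c - c') (x * coef c' r) else 0) \<in> zero_const"
  proof (cases "c' \<subseteq># c")
    case True
    then have "c' = c" using N c by (intro size_eq_subseteq_mset) auto
    moreover have "coef c r * x \<in> zero_const" using x by (rule ring_module.subspace_scale[OF is_ideal_zero_const])
    ultimately show ?thesis by (simp add: coef_empty_zero_const_iff mult.commute)
  qed (simp add: ring_module.subspace_0[OF is_ideal_zero_const])
qed

text \<open>Terms of \<open>r\<close> of exact order \<open>N\<close> have coefficients in
  \<open>zero_const\<close> and fall under \<open>zero_const_mult_order_ge\<close>; those of higher
  order leave an exponent of size below \<open>M\<close>, where multiples of \<open>s\<close> have
  no coefficient.\<close>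

lemma order_ge_zero_mult:
  assumes s: "s \<in> order_ge M" and r: "r \<in> order_ge_zero N" shows "s * r \<in> order_ge_zero (M + N)"
  unfolding order_ge_zero_def
proof (intro CollectI conjI allI impI)
  have rN: "r \<in> order_ge N" using r by (simp add: order_ge_zero_def)
  then show "s * r \<in> order_ge (M + N)" using s by (rule order_ge_mult[rotated])
  fix c :: "nat multiset" assume c: "size c = M + N"
  show "coef c (s * r) \<in> zero_const"
  proof (subst coef_mult_expand, rule ring_module.subspace_sum[OF is_ideal_zero_const])
    fix c' assume "c' \<in> Poly_Mapping.keys (cf r)"
    then have N: "N \<le> size c'" using rN unfolding order_ge_def in_keys_iff by (auto simp: not_less[symmetric])
    show "(if c' \<subseteq># c then coef (c - c') (s * coef c' r) else 0) \<in> zero_const"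
    proof (cases "c' \<subseteq># c")
      case True
      have sz: "size (c - c') = M + N - size c'" using True c by (simp add: size_Diff_submset)
      show ?thesis
      proof (cases "size c' = N")
        case True
        then have "coef c' r \<in> zero_const" using r by (simp add: order_ge_zero_def)
        then have "coef (c - c') (coef c' r * s) \<in> zero_const"
          using s by (rule zero_const_mult_order_ge) (simp add: sz True)
        then show ?thesis by (simp add: mult.commute ring_module.subspace_0[OF is_ideal_zero_const])
      next
        case False
        then have "size (c - c') < M" using N sz size_mset_mono[OF \<open>c' \<subseteq># c\<close>] c by linarith
        moreover have "coef c' r * s \<in> order_ge M" by (rule ring_module.subspace_scale[OF is_ideal_order_ge s])
        ultimately have "coef (c - c') (s * coef c' r) = 0" by (simp add: order_ge_def mult.commute)
        then show ?thesis by (simp add: ring_module.subspace_0[OF is_ideal_zero_const])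
      qed
    qed (simp add: ring_module.subspace_0[OF is_ideal_zero_const])
  qed
qed

lemma order_ge_zero_add: "r \<in> order_ge_zero N \<Longrightarrow> s \<in> order_ge_zero N \<Longrightarrow> r + s \<in> order_ge_zero N"
  by (simp add: order_ge_zero_def coef_add ring_module.subspace_add[OF is_ideal_order_ge] ring_module.subspace_add[OF is_ideal_zero_const])

lemma order_ge_zero_zero: "0 \<in> order_ge_zero N"
  by (simp add: order_ge_zero_def ring_module.subspace_0[OF is_ideal_order_ge] ring_module.subspace_0[OF is_ideal_zero_const])

lemma order_ge_zero_scale: "r \<in> order_ge_zero N \<Longrightarrow> s * r \<in> order_ge_zero N"
  using order_ge_zero_mult[of s 0 r N] by (simp add: order_ge_def)

lemma order_ge_zero_sum: "(\<And>x. x \<in> A \<Longrightarrow> f x \<in> order_ge_zero N) \<Longrightarrow> (\<Sum>x\<in>A. f x) \<in> order_ge_zero N"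
  by (induction A rule: infinite_finite_induct) (simp_all add: order_ge_zero_zero order_ge_zero_add)

text \<open>
  This separates relations with coefficients in \<open>K\<close> from those with coefficients in \<open>(x\<^sub>1, \<dots>, x\<^sub>n)\<close>.
\<close>

lemma coeff_rees_irrelevant:
  assumes "p \<in> rees_irrelevant J" shows "coeff p i \<in> order_ge_zero (i * e)"
proof -
  let ?Z = "{p \<in> carrier (rees_ring J). \<forall>i. coeff p i \<in> order_ge_zero (i * e)}"
  have R: "ring (rees_ring J)" by (rule ring_rees_ring)
  interpret R: ring "rees_ring J" by (rule R)
  have ops: "x \<oplus>\<^bsub>rees_ring J\<^esub> y = x + y" "x \<otimes>\<^bsub>rees_ring J\<^esub> y = x * y" "\<zero>\<^bsub>rees_ring J\<^esub> = 0" for x y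
    by (simp_all add: rees_ring_def)
  have mult: "p * q \<in> ?Z" if q: "q \<in> ?Z" and p: "p \<in> carrier (rees_ring J)" for p q
  proof -
    have "coeff p j * coeff q (i - j) \<in> order_ge_zero (i * e)" if "j \<le> i" for i j
    proof -
      have "coeff p j \<in> order_ge (j * e)" using p ideal_power_J_order_ge by (auto simp: rees_ring_def)
      then have "coeff p j * coeff q (i - j) \<in> order_ge_zero (j * e + (i - j) * e)"
        using q by (intro order_ge_zero_mult) auto
      also have "j * e + (i - j) * e = i * e" using that by (simp flip: add_mult_distrib)
      finally show ?thesis .
    qed
    then have "coeff (p * q) i \<in> order_ge_zero (i * e)" for i
      unfolding coeff_mult by (intro order_ge_zero_sum) auto
    moreover have "p * q \<in> carrier (rees_ring J)" using R.m_closed[of p q] p q by (simp add: ops)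
    ultimately show ?thesis by simp
  qed
  have "ideal ?Z (rees_ring J)"
  proof (rule idealI[OF R])
    show "subgroup ?Z (add_monoid (rees_ring J))"
    proof (rule R.add.subgroupI)
      have "0 \<in> ?Z" using R.zero_closed by (simp add: ops order_ge_zero_zero)
      then show "?Z \<noteq> {}" by blast
    next
      fix p assume p: "p \<in> ?Z"
      have "p \<oplus>\<^bsub>rees_ring J\<^esub> (- p) = \<zero>\<^bsub>rees_ring J\<^esub>" by (simp add: ops)
      moreover have "- p \<in> carrier (rees_ring J)"
        using p by (simp add: rees_ring_def ring_module.subspace_neg[OF is_ideal_ideal_power])
      ultimately have "\<ominus>\<^bsub>rees_ring J\<^esub> p = - p"
        using p R.minus_equality[of "- p" p] by (simp add: ops)
      moreover have "coeff (- p) i \<in> order_ge_zero (i * e)" for i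
        using order_ge_zero_scale[of "coeff p i" "i * e" "-1"] p by simp
      ultimately show "\<ominus>\<^bsub>rees_ring J\<^esub> p \<in> ?Z" using \<open>- p \<in> carrier (rees_ring J)\<close> by simp
    next
      fix p q assume "p \<in> ?Z" "q \<in> ?Z"
      then show "p \<oplus>\<^bsub>rees_ring J\<^esub> q \<in> ?Z"
        using R.a_closed[of p q] by (simp add: ops order_ge_zero_add)
    qed blast
    show "x \<otimes>\<^bsub>rees_ring J\<^esub> p \<in> ?Z" if "p \<in> ?Z" "x \<in> carrier (rees_ring J)" for p x
      using mult[OF that] by (simp add: ops)
    show "p \<otimes>\<^bsub>rees_ring J\<^esub> x \<in> ?Z" if "p \<in> ?Z" "x \<in> carrier (rees_ring J)" for p x
      using mult[OF that] by (simp add: ops mult.commute)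
  qed
  moreover have "{[:mp_var i:] | i. True} \<subseteq> ?Z"
  proof clarify
    fix i :: 'n
    \<comment> \<open>The variables sit in degree 0 of \<open>\<tau>\<close>, where the condition
      reduces to membership in \<open>zero_const\<close>.\<close>
    have "mp_var i \<in> order_ge_zero 0"
    proof -
      have "(mp_var i :: ('n, 'k) mpoly) \<in> zero_const"
        by (simp add: zero_const_def mp_var_def lookup_single when_def) (metis keys_single keys_zero insert_not_empty nat.distinct(1))
      then show ?thesis by (simp add: order_ge_zero_def order_ge_def coef_empty_zero_const_iff)
    qed
    moreover have "coeff [:mp_var i :: ('n, 'k) mpoly:] k = (if k = 0 then mp_var i else 0)" for k :: nat
      by (simp add: coeff_pCons split: nat.split)
    moreover have "(0 :: ('n, 'k) mpoly) \<in> ideal_power J k" for k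
      by (rule ring_module.subspace_0[OF is_ideal_ideal_power])
    ultimately show "[:mp_var i:] \<in> carrier (rees_ring J) \<and> (\<forall>k. coeff [:mp_var i:] k \<in> order_ge_zero (k * e))"
      by (auto simp: rees_ring_def order_ge_zero_zero simp del: coeff_pCons_0)
  qed
  ultimately have "rees_irrelevant J \<subseteq> ?Z"
    unfolding rees_irrelevant_def by (rule R.genideal_minimal)
  then show ?thesis using assms by blast
qed

end

section \<open>Equations of the Rees algebra and the fiber cone\<close>

lemma extend_coeffs_quadric:
  "extend_coeffs (mp_var x * mp_var y - mp_var z * mp_var w :: ('m, 'k::field) mpoly) =
     (mp_var x * mp_var y - mp_var z * mp_var w :: ('m, ('n, 'k) mpoly) mpoly)"
proof (rule poly_mapping_eqI)
  fix a :: "'m \<Rightarrow>\<^sub>0 nat"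
  show "Poly_Mapping.lookup (extend_coeffs (mp_var x * mp_var y - mp_var z * mp_var w :: ('m, 'k) mpoly) :: ('m, ('n, 'k) mpoly) mpoly) a =
    Poly_Mapping.lookup (mp_var x * mp_var y - mp_var z * mp_var w :: ('m, ('n, 'k) mpoly) mpoly) a"
    by (simp add: lookup_extend_coeffs mp_var_def mult_single lookup_minus lookup_single when_def mp_const_def single_uminus)
qed

context veronese_bijection
begin

lemma swap_tmon:
  assumes "swap \<alpha> \<beta>"
  shows "\<exists>r q. q \<in> quadrics u \<and> (tmon \<alpha> - tmon \<beta> :: ('m, 'k::comm_ring_1) mpoly) = r * q"
proof -
  obtain \<gamma> x y z w where *: "u x + u y = u z + u w" "\<alpha> = \<gamma> + {#x, y#}" "\<beta> = \<gamma> + {#z, w#}"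
    using assms unfolding swap_def by blast
  have "tmon \<alpha> - tmon \<beta> = tmon \<gamma> * (mp_var x * mp_var y - mp_var z * mp_var w)"
    unfolding *(2,3) by (simp add: algebra_simps)
  then show ?thesis using *(1) unfolding quadrics_def by blast
qed

lemma swaps_tmon:
  "swaps \<alpha> \<beta> \<Longrightarrow> (tmon \<alpha> - tmon \<beta> :: ('m, 'k::comm_ring_1) mpoly) \<in> ideal_gen (quadrics u)"
proof (induction rule: rtranclp_induct)
  case base
  then show ?case by (simp add: ideal_gen_zero)
next
  case (step \<beta> \<beta>')
  obtain r and q :: "('m, 'k) mpoly" where "q \<in> quadrics u" "tmon \<beta> - tmon \<beta>' = r * q"
    using swap_tmon[OF step.hyps(2)] by blast
  then have "tmon \<beta> - tmon \<beta>' \<in> ideal_gen (quadrics u :: ('m, 'k) mpoly set)"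
    by (simp add: ideal_gen_mult ideal_gen_base)
  then show ?case using ideal_gen_add[OF step.IH] by fastforce
qed

end

context star_rees
begin

section \<open>Equations of the fiber cone\<close>

lemma zero_mem_rees_irrelevant: "0 \<in> rees_irrelevant J"
proof -
  have "0 \<in> A" if "ideal A (rees_ring J)" for A
    using additive_subgroup.zero_closed[OF ideal.axioms(1)[OF that]] by (simp add: rees_ring_def)
  then show ?thesis by (auto simp: rees_irrelevant_def genideal_def)
qed

lemma fiber_map_eq: "fiber_map J g p = (\<lambda>q. q + rees_map g (extend_coeffs p)) ` rees_irrelevant J"
  by (auto simp: fiber_map_def a_r_coset_def' rees_ring_def)

lemma mem_fiber_defining_idealD:
  assumes "p \<in> fiber_defining_ideal J g" shows "rees_map g (extend_coeffs p) \<in> rees_irrelevant J"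
proof -
  have "fiber_map J g p = rees_irrelevant J"
    using assms by (simp add: fiber_defining_ideal_def fiber_cone_def FactRing_def)
  moreover have "0 + rees_map g (extend_coeffs p) \<in> fiber_map J g p"
    unfolding fiber_map_eq using zero_mem_rees_irrelevant by (rule imageI)
  ultimately show ?thesis by simp
qed

lemma mem_fiber_defining_idealI:
  "rees_map g (extend_coeffs p) = 0 \<Longrightarrow> p \<in> fiber_defining_ideal J g"
  by (simp add: fiber_defining_ideal_def fiber_cone_def FactRing_def fiber_map_eq)

text \<open>In degree \<open>k\<close> all products of generators have exponents of size
  \<open>k * e\<close>, the lowest order allowed. At an exponent \<open>c\<close> of that size a
  product contributes only if its exponent equals \<open>c\<close>, so the coefficient of the image
  there is \<open>coef {#}\<close> of a scalar, the class sum. It lies in the irrelevant ideal,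
  hence the scalar is 0.\<close>

lemma fiber_class_sum_zero:
  assumes p: "p \<in> fiber_defining_ideal J g"
  shows "(\<Sum>a\<in>{a\<in>Poly_Mapping.keys p. (weight (exponent_mset a), mdeg a) = y}. Poly_Mapping.lookup p a) = 0"
proof (cases "\<exists>a. (weight (exponent_mset a), mdeg a) = y")
  case False
  then show ?thesis by simp
next
  case True
  then obtain a0 where a0: "(weight (exponent_mset a0), mdeg a0) = y" by blast
  define c k where "c = weight (exponent_mset a0)" and "k = mdeg a0"
  have y: "y = (c, k)" using a0 by (simp add: c_def k_def)
  have c: "size c = k * e" by (simp add: c_def k_def size_weight size_exponent_mset)
  let ?s = "\<Sum>a\<in>{a\<in>Poly_Mapping.keys p. (weight (exponent_mset a), mdeg a) = y}. Poly_Mapping.lookup p a"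
  have "coeff (rees_map g (extend_coeffs p)) k =
      (\<Sum>a\<in>{a\<in>Poly_Mapping.keys p. mdeg a = k}. mp_const (Poly_Mapping.lookup p a) * fmon F (weight (exponent_mset a)))"
    unfolding rees_map_ext coeff_mp_eval_monom prod_g ..
  then have "coef c (coeff (rees_map g (extend_coeffs p)) k) =
      (\<Sum>a\<in>{a\<in>Poly_Mapping.keys p. mdeg a = k}. coef c (mp_const (Poly_Mapping.lookup p a) * fmon F (weight (exponent_mset a))))"
    by (simp add: coef_sum)
  also have "\<dots> = (\<Sum>a\<in>{a\<in>Poly_Mapping.keys p. mdeg a = k}.
      if weight (exponent_mset a) = c then coef {#} (mp_const (Poly_Mapping.lookup p a)) else 0)"
  proof (intro sum.cong refl)
    fix a assume "a \<in> {a \<in> Poly_Mapping.keys p. mdeg a = k}"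
    then have "size (weight (exponent_mset a)) = size c" by (simp add: c size_weight size_exponent_mset)
    then have "weight (exponent_mset a) \<subseteq># c \<longleftrightarrow> weight (exponent_mset a) = c"
      using size_eq_subseteq_mset[of "weight (exponent_mset a)" c] by auto
    then show "coef c (mp_const (Poly_Mapping.lookup p a) * fmon F (weight (exponent_mset a))) =
      (if weight (exponent_mset a) = c then coef {#} (mp_const (Poly_Mapping.lookup p a)) else 0)"
      by (simp add: coef_fmon[OF set_weight])
  qed
  also have "\<dots> = (\<Sum>a\<in>{a\<in>Poly_Mapping.keys p. (weight (exponent_mset a), mdeg a) = y}. coef {#} (mp_const (Poly_Mapping.lookup p a)))"
    by (subst sum.inter_filter[symmetric]) (auto simp: y intro!: sum.cong)
  also have "\<dots> = coef {#} (mp_const ?s)"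
    by (simp add: mp_const_def single_sum coef_sum)
  finally have "coef {#} (mp_const ?s) = coef c (coeff (rees_map g (extend_coeffs p)) k)" ..
  also have "\<dots> \<in> zero_const"
    using coeff_rees_irrelevant[OF mem_fiber_defining_idealD[OF p], of k] c by (simp add: order_ge_zero_def)
  finally show ?thesis by (rule coef_const_zero_constD)
qed

lemma quadrics_subset_fiber_defining_ideal: "quadrics u \<subseteq> fiber_defining_ideal J g"
  and ideal_gen_quadrics_kernel: "p \<in> ideal_gen (quadrics u) \<Longrightarrow> rees_map g (extend_coeffs p) = 0"
proof -
  let ?K = "{p. rees_map g (extend_coeffs p) = 0}"
  have ideal: "is_ideal ?K"
    by (rule is_idealI) (simp_all add: rees_map_ext rees_ext.mp_eval_zero rees_ext.mp_eval_add rees_ext.mp_eval_mult)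
  have "quadrics u \<subseteq> ?K"
  proof
    fix q :: "('m, 'k) mpoly" assume "q \<in> quadrics u"
    then obtain x y z w where q: "q = mp_var x * mp_var y - mp_var z * mp_var w" and eq: "u x + u y = u z + u w"
      by (auto simp: quadrics_def)
    have "g x * g y = g z * g w" using eq by (metis fmon_simps(3))
    then show "q \<in> ?K"
      by (simp add: q rees_map_ext rees_ext.mp_eval_diff rees_ext.mp_eval_mult rees_ext.mp_eval_var mult_monom)
  qed
  then show "quadrics u \<subseteq> fiber_defining_ideal J g" by (auto intro: mem_fiber_defining_idealI)
  show "rees_map g (extend_coeffs p) = 0" if "p \<in> ideal_gen (quadrics u)"
    using ideal_gen_minimal[OF \<open>quadrics u \<subseteq> ?K\<close> ideal] that by blast
qed

lemma fiber_defining_ideal_eq: "fiber_defining_ideal J g = ideal_gen (quadrics u)"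
proof (intro equalityI subsetI)
  fix p assume p: "p \<in> fiber_defining_ideal J g"
  \<comment> \<open>The degree is a separate label, since the weight determines it only for
    \<open>e > 0\<close>.\<close>
  let ?f = "\<lambda>a. (weight (exponent_mset a), mdeg a)"
  have "(\<Sum>a\<in>Poly_Mapping.keys p. Poly_Mapping.single 0 (Poly_Mapping.lookup p a) * tmon (exponent_mset a)) \<in> ideal_gen (quadrics u)"
  proof (rule class_sum_mem_ideal[where f = ?f])
    show "(\<Sum>a\<in>{a\<in>Poly_Mapping.keys p. ?f a = y}. Poly_Mapping.single 0 (Poly_Mapping.lookup p a)) = (0 :: ('m, 'k) mpoly)" for y
      using fiber_class_sum_zero[OF p, of y] by (simp flip: single_sum)
    show "tmon (exponent_mset a) - tmon (exponent_mset b) \<in> ideal_gen (quadrics u :: ('m, 'k) mpoly set)" if "?f a = ?f b" for a b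
      using that by (intro swaps_tmon swaps_if_weight_eq) (simp_all add: size_exponent_mset)
  qed (simp_all add: is_ideal_ideal_gen)
  then show "p \<in> ideal_gen (quadrics u)" using mpoly_sum_tmon[of p] by simp
qed (simp add: ideal_gen_quadrics_kernel mem_fiber_defining_idealI)

section \<open>Equations of the Rees algebra\<close>

definition fiber_relations :: "('m, ('n, 'k) mpoly) mpoly set" where
  "fiber_relations = linear_part g + ideal_gen (extend_coeffs ` fiber_defining_ideal J g)"

lemma is_ideal_fiber_relations: "is_ideal fiber_relations"
  unfolding fiber_relations_def linear_part_def by (intro is_ideal_sum_set is_ideal_ideal_gen)

lemma linear_part_subset: "linear_part g \<subseteq> fiber_relations"
  unfolding fiber_relations_def using set_plus_intro[OF _ ideal_gen_zero] by fastforce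

lemma quadrics_subset: "quadrics u \<subseteq> fiber_relations"
proof
  fix q :: "('m, ('n, 'k) mpoly) mpoly" assume "q \<in> quadrics u"
  then obtain x y z w where q: "q = mp_var x * mp_var y - mp_var z * mp_var w" and eq: "u x + u y = u z + u w"
    by (auto simp: quadrics_def)
  have "mp_var x * mp_var y - mp_var z * mp_var w \<in> (quadrics u :: ('m, 'k) mpoly set)"
    using eq unfolding quadrics_def by blast
  then have "mp_var x * mp_var y - mp_var z * mp_var w \<in> fiber_defining_ideal J g"
    using quadrics_subset_fiber_defining_ideal by blast
  then have "q \<in> ideal_gen (extend_coeffs ` fiber_defining_ideal J g)"
    unfolding q extend_coeffs_quadric[symmetric] by (intro ideal_gen_base imageI)
  moreover have "0 \<in> linear_part g" unfolding linear_part_def by (rule ideal_gen_zero)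
  ultimately have "0 + q \<in> fiber_relations" unfolding fiber_relations_def by (intro set_plus_intro)
  then show "q \<in> fiber_relations" by simp
qed

text \<open>The coefficient fills the exponent up to \<open>c\<close>: if
  \<open>weight \<alpha> \<subseteq># c\<close>, the image in the Rees algebra is
  \<open>fmon F c\<close> times a power of \<open>\<tau>\<close> depending only on the size of
  \<open>\<alpha>\<close>.\<close>

definition lifted :: "nat multiset \<Rightarrow> 'm multiset \<Rightarrow> ('m, ('n, 'k) mpoly) mpoly" where
  "lifted c \<alpha> = Poly_Mapping.single 0 (fmon F (c - weight \<alpha>)) * tmon \<alpha>"

lemma move_lifted:
  assumes "move c \<alpha> \<beta>" "weight \<alpha> \<subseteq># c"
  shows "weight \<beta> \<subseteq># c \<and> lifted c \<alpha> - lifted c \<beta> \<in> fiber_relations"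
proof -
  consider "swap \<alpha> \<beta>" | \<gamma> x y where "\<alpha> = add_mset x \<gamma>" "\<beta> = add_mset y \<gamma>" "weight \<beta> \<subseteq># c"
    using assms(1) unfolding move_def by blast
  then show ?thesis
  proof cases
    case 1
    then obtain r and q :: "('m, ('n, 'k) mpoly) mpoly" where q: "q \<in> quadrics u" "tmon \<alpha> - tmon \<beta> = r * q"
      using swap_tmon by blast
    have w: "weight \<beta> = weight \<alpha>" using 1 by (rule swap_weight)
    have "lifted c \<alpha> - lifted c \<beta> = (Poly_Mapping.single 0 (fmon F (c - weight \<alpha>)) * r) * q"
      unfolding lifted_def w right_diff_distrib[symmetric] q(2) mult.assoc ..
    also have "\<dots> \<in> fiber_relations"
      using q(1) quadrics_subset by (intro ring_module.subspace_scale[OF is_ideal_fiber_relations]) blast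
    finally show ?thesis using w assms(2) by simp
  next
    case 2
    \<comment> \<open>\<open>L\<close> is the difference with the common factor
      \<open>tmon \<gamma>\<close> divided out. Both of its terms map to
      \<open>fmon F (c - weight \<gamma>)\<close> times \<open>\<tau>\<close>, so it is a relation
      linear in the \<open>T\<close>-variables.\<close>
    define L where "L = Poly_Mapping.single 0 (fmon F (c - weight \<alpha>)) * mp_var x -
      (Poly_Mapping.single 0 (fmon F (c - weight \<beta>)) * mp_var y :: ('m, ('n, 'k) mpoly) mpoly)"
    have "fmon F (c - weight \<alpha>) * g x = fmon F (c - weight \<gamma>)" "fmon F (c - weight \<beta>) * g y = fmon F (c - weight \<gamma>)"
    proof -
      have *: "c - weight (add_mset z \<gamma>) + u z = c - weight \<gamma>" if "weight (add_mset z \<gamma>) \<subseteq># c" for z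
      proof (rule multiset_eqI)
        fix i
        have "count (weight (add_mset z \<gamma>)) i \<le> count c i" using that by (simp only: subseteq_mset_def)
        then show "count (c - weight (add_mset z \<gamma>) + u z) i = count (c - weight \<gamma>) i" by simp
      qed
      show "fmon F (c - weight \<alpha>) * g x = fmon F (c - weight \<gamma>)"
        using *[of x] assms(2) 2(1) by (metis fmon_simps(3))
      show "fmon F (c - weight \<beta>) * g y = fmon F (c - weight \<gamma>)"
        using *[of y] 2(2,3) by (metis fmon_simps(3))
    qed
    then have "rees_map g L = 0"
      using rees_map_tmon[of g "fmon F (c - weight \<alpha>)" "{#x#}"] rees_map_tmon[of g "fmon F (c - weight \<beta>)" "{#y#}"]
      by (simp add: L_def rees_map_def rees.mp_eval_diff)
    moreover have "homogeneous 1 L"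
    proof -
      have "Poly_Mapping.keys L \<subseteq> {Poly_Mapping.single x 1, Poly_Mapping.single y 1}"
        unfolding L_def mp_var_def mult_single by (rule order_trans[OF keys_diff]) simp
      moreover have "mdeg (Poly_Mapping.single z 1) = 1" for z :: 'm
        by (simp add: mdeg_def lookup_single when_def)
      ultimately show ?thesis unfolding homogeneous_def by blast
    qed
    ultimately have "L \<in> linear_part g"
      unfolding linear_part_def rees_defining_ideal_def by (intro ideal_gen_base) simp
    moreover have "lifted c \<alpha> - lifted c \<beta> = tmon \<gamma> * L"
      by (simp add: lifted_def L_def 2(1,2) algebra_simps)
    ultimately have "lifted c \<alpha> - lifted c \<beta> \<in> fiber_relations"
      using linear_part_subset ring_module.subspace_scale[OF is_ideal_fiber_relations] by auto
    then show ?thesis using 2(3) by blast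
  qed
qed

lemma moves_lifted:
  "(move c)\<^sup>*\<^sup>* \<alpha> \<beta> \<Longrightarrow> weight \<alpha> \<subseteq># c \<Longrightarrow>
     weight \<beta> \<subseteq># c \<and> lifted c \<alpha> - lifted c \<beta> \<in> fiber_relations"
proof (induction rule: rtranclp_induct)
  case base
  then show ?case by (simp add: ring_module.subspace_0[OF is_ideal_fiber_relations])
next
  case (step \<beta> \<beta>')
  then have "weight \<beta>' \<subseteq># c" "lifted c \<beta> - lifted c \<beta>' \<in> fiber_relations" "lifted c \<alpha> - lifted c \<beta> \<in> fiber_relations"
    using move_lifted by blast+
  then show ?case using ring_module.subspace_add[OF is_ideal_fiber_relations, of "lifted c \<alpha> - lifted c \<beta>" "lifted c \<beta> - lifted c \<beta>'"] by simp
qed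

lemma rees_defining_ideal_subset: "rees_defining_ideal g \<subseteq> fiber_relations"
proof
  fix p assume p: "p \<in> rees_defining_ideal g"
  let ?l = "Poly_Mapping.lookup p" and ?E = exponent_mset
  define A where "A = Sigma (Poly_Mapping.keys p) (\<lambda>a. Poly_Mapping.keys (cf (?l a)))"
  define s where "s = (\<lambda>(a, c). Poly_Mapping.single 0 (coef c (?l a)) :: ('m, ('n, 'k) mpoly) mpoly)"
  define M where "M = (\<lambda>(a, c). Poly_Mapping.single 0 (fmon F c) * tmon (?E a) :: ('m, ('n, 'k) mpoly) mpoly)"
  \<comment> \<open>\<open>f\<close> records the image of the term \<open>M\<close>: its exponent in
    the \<open>F i\<close> and its power of \<open>\<tau>\<close>.\<close>
  define f where "f = (\<lambda>(a, c). (c + weight (?E a), mdeg a))"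
  have "Poly_Mapping.single 0 (?l a) * tmon (?E a) = (\<Sum>c\<in>Poly_Mapping.keys (cf (?l a)). s (a, c) * M (a, c))" for a
  proof -
    have "Poly_Mapping.single 0 (?l a) = (\<Sum>c\<in>Poly_Mapping.keys (cf (?l a)). Poly_Mapping.single 0 (coef c (?l a) * fmon F c) :: ('m, ('n, 'k) mpoly) mpoly)"
      unfolding single_sum[symmetric] by (rule arg_cong[OF expand])
    then show ?thesis
      by (simp add: s_def M_def sum_distrib_right mult.assoc[symmetric] mult_single)
  qed
  then have "p = (\<Sum>a\<in>Poly_Mapping.keys p. \<Sum>c\<in>Poly_Mapping.keys (cf (?l a)). s (a, c) * M (a, c))"
    using mpoly_sum_tmon[of p] by simp
  also have "\<dots> = (\<Sum>x\<in>A. s x * M x)" unfolding A_def by (subst sum.Sigma) simp_all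
  also have "\<dots> \<in> fiber_relations"
  proof (rule class_sum_mem_ideal[OF is_ideal_fiber_relations, where f = f])
    show "finite A" by (simp add: A_def)
    show "(\<Sum>x\<in>{x\<in>A. f x = y}. s x) = 0" for y
    proof (cases y)
      case (Pair c k)
      \<comment> \<open>For fixed \<open>a\<close>, the exponent \<open>c'\<close> must be
        \<open>c\<close> minus the weight, and the shift rule turns this into the coefficient at
        \<open>c\<close> after multiplying by the product of generators. Summed over
        \<open>a\<close>, it is a coefficient of the image of \<open>p\<close>, which is 0.\<close>
      have inner: "(\<Sum>c'\<in>Poly_Mapping.keys (cf (?l a)). if f (a, c') = y then coef c' (?l a) else 0) =
          (if mdeg a = k then coef c (?l a * fmon F (weight (?E a))) else 0)" for a
      proof (cases "mdeg a = k \<and> weight (?E a) \<subseteq># c")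
        case True
        then have "f (a, c') = y \<longleftrightarrow> c - weight (?E a) = c'" for c'
          by (auto simp: f_def Pair)
        then show ?thesis using True by (simp add: coef_fmon[OF set_weight] sum.delta in_keys_iff)
      next
        case False
        then have "f (a, c') \<noteq> y" for c' by (auto simp: f_def Pair)
        then show ?thesis using False by (auto simp: coef_fmon[OF set_weight])
      qed
      have "(\<Sum>x\<in>{x\<in>A. f x = y}. case x of (a, c') \<Rightarrow> coef c' (?l a)) = (\<Sum>x\<in>A. if f x = y then (case x of (a, c') \<Rightarrow> coef c' (?l a)) else 0)"
        by (simp add: A_def sum.inter_filter)
      also have "\<dots> = (\<Sum>a\<in>Poly_Mapping.keys p. \<Sum>c'\<in>Poly_Mapping.keys (cf (?l a)). if f (a, c') = y then coef c' (?l a) else 0)"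
        unfolding A_def by (subst sum.Sigma) (auto intro!: sum.cong)
      also have "\<dots> = (\<Sum>a\<in>{a\<in>Poly_Mapping.keys p. mdeg a = k}. coef c (?l a * fmon F (weight (?E a))))"
        by (simp add: inner sum.inter_filter)
      also have "\<dots> = coef c (coeff (rees_map g p) k)"
        unfolding rees_map_def coeff_mp_eval_monom prod_g coef_sum ..
      also have "\<dots> = 0" using p by (simp add: rees_defining_ideal_def)
      finally have "(\<Sum>x\<in>{x\<in>A. f x = y}. case x of (a, c') \<Rightarrow> coef c' (?l a)) = 0" .
      moreover have "s x = Poly_Mapping.single 0 (case x of (a, c') \<Rightarrow> coef c' (?l a))" for x
        by (simp add: s_def split: prod.split)
      ultimately show ?thesis by (simp flip: single_sum)
    qed
    show "M x - M y \<in> fiber_relations" if "f x = f y" for x y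
    proof -
      obtain a c b c' where xy: "x = (a, c)" "y = (b, c')" by fastforce
      define d where "d = c + weight (?E a)"
      have d: "d = c' + weight (?E b)" "mdeg a = mdeg b" using that by (simp_all add: f_def xy d_def)
      have "(move d)\<^sup>*\<^sup>* (?E a) (?E b)"
      proof (rule moves_if_weight_le)
        show "weight (?E b) \<subseteq># d" by (simp add: d(1))
      qed (simp_all add: size_exponent_mset d(2) d_def)
      then have "lifted d (?E a) - lifted d (?E b) \<in> fiber_relations"
        using moves_lifted by (simp add: d_def)
      moreover have "M x = lifted d (?E a)" "M y = lifted d (?E b)"
        by (simp add: M_def lifted_def xy d_def) (simp add: M_def lifted_def xy d(1))
      ultimately show ?thesis by simp
    qed
  qed
  finally show "p \<in> fiber_relations" .
qed

lemma fiber_type_J: "fiber_type J g"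
proof -
  have "linear_part g \<subseteq> rees_defining_ideal g"
    unfolding linear_part_def by (rule ideal_gen_minimal[OF _ is_ideal_rees_defining_ideal]) auto
  moreover have "ideal_gen (extend_coeffs ` fiber_defining_ideal J g) \<subseteq> rees_defining_ideal g"
    by (rule ideal_gen_minimal[OF _ is_ideal_rees_defining_ideal])
      (auto simp: fiber_defining_ideal_eq rees_defining_ideal_def ideal_gen_quadrics_kernel)
  ultimately have "fiber_relations \<subseteq> rees_defining_ideal g"
    unfolding fiber_relations_def
    using ring_module.subspace_add[OF is_ideal_rees_defining_ideal, of _ g]
    by (blast elim: set_plus_elim)
  then show ?thesis
    using rees_defining_ideal_subset unfolding fiber_type_def fiber_relations_def by blast
qed

end

theorem theorem1p2:
  fixes F :: "nat \<Rightarrow> ('n::finite, 'k::field) mpoly" and t c m :: nat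
    and I :: "('n, 'k) mpoly set"
  assumes "\<forall>i\<in>{1..t}. \<exists>d. homogeneous d (F i)"
    and "regular_sequence F t"
    and "2 \<le> c" and "c \<le> min CARD('n) t"
    and "I = star_configuration c F t"
    and "1 \<le> m"
  shows "(\<exists>G. minimal_generating_set (ideal_power I m) G \<and> G \<subseteq> power_products F t) \<and>
    (\<forall>g :: 'm::finite \<Rightarrow> ('n, 'k) mpoly.
       inj g \<and> minimal_generating_set (ideal_power I m) (range g) \<and> range g \<subseteq> power_products F t \<longrightarrow>
         fiber_type (ideal_power I m) g \<and>
         (\<exists>B. fiber_defining_ideal (ideal_power I m) g = ideal_gen B \<and>
              (\<forall>p\<in>B. total_degree p \<le> 2)))"
proof -
  obtain cf where "monomial_expansion F t cf"
    using regular_sequence_monomial_expansion[OF assms(1,2)] by metis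
  then interpret monomial_expansion F t cf .
  define e where "e = m * (t - c + 1)"
  define V where "V = veronese t e m"
  have V: "set_mset a \<subseteq> {1..t}" "size a = e" if "a \<in> V" for a
    using that by (auto simp: V_def veronese_def)
  have "I = ideal_gen (fmon F ` veronese t (t - c + 1) 1)"
    unfolding assms(5) using assms(4) by (intro star_configuration_eq) simp
  then have power: "ideal_power I m = ideal_gen (fmon F ` V)"
    by (simp only: ideal_power_veronese V_def e_def)
  have "minimal_generating_set (ideal_power I m) (fmon F ` V)"
    unfolding power using V finite_veronese by (intro minimal_generating_set_fmon) (auto simp: V_def)
  moreover have "fmon F ` V \<subseteq> power_products F t"
    using V by (auto simp: power_products_eq)
  moreover have "fiber_type (ideal_power I m) g \<and>
      (\<exists>B. fiber_defining_ideal (ideal_power I m) g = ideal_gen B \<and> (\<forall>p\<in>B. total_degree p \<le> 2))"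
    if g: "inj g" "minimal_generating_set (ideal_power I m) (range g)" "range g \<subseteq> power_products F t"
    for g :: "'m \<Rightarrow> ('n, 'k) mpoly"
  proof -
    have range: "range g = fmon F ` V"
      using minimal_generating_set_unique[OF V] g(2,3) unfolding power by blast
    have inj: "inj_on (fmon F) V" using V fmon_inj by (intro inj_onI) blast
    \<comment> \<open>\<open>u\<close> recovers the exponents, so that the arbitrary family
      \<open>g\<close> becomes the one treated in \<open>star_rees\<close>.\<close>
    define u where "u = inv_into V (fmon F) \<circ> g"
    have "bij_betw g UNIV (fmon F ` V)" using g(1) range by (simp add: bij_betw_def)
    moreover have "bij_betw (inv_into V (fmon F)) (fmon F ` V) V"
      using inj by (intro bij_betw_inv_into) (simp add: bij_betw_def)
    ultimately have u: "bij_betw u UNIV (veronese t e m)"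
      unfolding u_def V_def by (rule bij_betw_trans)
    have gu: "g = (\<lambda>x. fmon F (u x))"
    proof
      fix x
      have "g x \<in> fmon F ` V" using range by blast
      then show "g x = fmon F (u x)" by (simp add: u_def f_inv_into_f)
    qed
    have lookup_F: "Poly_Mapping.lookup (F i) 0 = 0" if i: "i \<in> {1..t}" for i
    proof -
      obtain d where d: "homogeneous d (F i)" using assms(1) i by blast
      have "d > 0" by (rule regular_sequence_homogeneous_degree_pos[OF assms(2) i d])
      then have "0 \<notin> Poly_Mapping.keys (F i)" using d by (auto simp: homogeneous_def)
      then show ?thesis by (simp add: in_keys_iff)
    qed
    interpret star_rees F t cf u e m
      by unfold_locales (use u lookup_F in auto)
    have J: "ideal_power I m = J" by (simp add: J_def power V_def)
    show ?thesis
      unfolding gu J fiber_defining_ideal_eq using fiber_type_J total_degree_quadrics by blast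
  qed
  ultimately show ?thesis by blast
qed

end
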